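(* Let $G$ be a group acting on a field $L$ by automorphisms, let $K\subseteq L^G$ be a subring, and let $R=K[a_1,\dots,a_n]\subseteq L$ be a finitely generated $G$-stable $K$-subalgebra with $\operatorname{Quot}(R)=L$. Let $E\subseteq L[y_1,\dots,y_n]$ be an extended Derksen ideal with respect to $a_1,\dots,a_n$. Let $\mathcal G$ be a reduced Gr\"obner basis of $E$ with respect to an arbitrary monomial ordering, and let $A\subseteq L$ be the $K$-subalgebra generated by the coefficients of all polynomials from $\mathcal G$. Consider the invariantization map $\phi_{\mathcal G}\colon R\to A$ defined as follows: for $b\in R$ write $b=f(a_1,\dots,a_n)$ with $f\in K[y_1,\dots,y_n]$ and set \[ \phi_{\mathcal G}(b):=\bigl(\operatorname{NF}_{\mathcal G}(f)\bigr)(0,\dots,0). \] Then $\phi_{\mathcal G}$ is a well-defined homomorphism of $R^G$-modules, and it restricts to the identity on $R^G$. If $a\in R^G$ is a nonzero invariant with $A\subseteq R_a$ and $R^G_a=A_a$, then $\phi_{\mathcal G}$ uniquely extends to an $R^G_a$-linear projection $R_a\twoheadrightarrow R^G_a$, and in particular $R^G_a$ is a direct summand of $R_a$ (as an $R_a^G$-module).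
   Context: Rings are commutative with identity. $\operatorname{Quot}$ denotes the field of fractions. For a subring $B\subseteq L$ and $0\ne a\in B$, $B_a:=B[a^{-1}]\subseteq L$; $R^G_a:=(R^G)[a^{-1}]$. $G$ acts on $L[y_1,\dots,y_n]$ coefficient-wise, fixing the indeterminates $y_i$. Reduced Gr\"obner bases consist of monic polynomials; $\operatorname{NF}_{\mathcal G}$ denotes the normal form map $L[y_1,\dots,y_n]\to L[y_1,\dots,y_n]$ with respect to $\mathcal G$. The Derksen ideal with respect to $a_1,\dots,a_n$ is $D_{a_1,\dots,a_n}:=\bigcap_{\sigma\in G}(y_1-\sigma\cdot a_1,\dots,y_n-\sigma\cdot a_n)\subseteq L[y_1,\dots,y_n]$. An extended Derksen ideal (with respect to $a_1,\dots,a_n$) is a proper $G$-stable ideal $E\subsetneqq L[y_1,\dots,y_n]$ containing $D_{a_1,\dots,a_n}$. *)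

theory Defs
  imports
    "HOL-Library.Poly_Mapping"
    "HOL-Algebra.Algebra"
    "HOL-Algebra.Algebraic_Closure_Type"
begin

text \<open>The ambient field is a type of class \<open>field\<close>, viewed as a HOL-Algebra ring by
  \<^const>\<open>ring_of_type_algebra\<close>. Subrings of it are subsets.\<close>

abbreviation sub_ring :: "'l::comm_ring_1 set \<Rightarrow> 'l ring" where
  "sub_ring S \<equiv> ring_of_type_algebra\<lparr>carrier := S\<rparr>"

definition sub_mod :: "'l::comm_ring_1 set \<Rightarrow> ('l, 'l) module" where
  "sub_mod M = \<lparr>carrier = M, monoid.mult = (*), one = 1, ring.zero = 0, add = (+), module.smult = (*)\<rparr>"

definition is_module_hom ::
  "('a, 'm) ring_scheme \<Rightarrow> ('a, 'b, 'p) module_scheme \<Rightarrow> ('a, 'c, 'q) module_scheme \<Rightarrow> ('b \<Rightarrow> 'c) \<Rightarrow> bool"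
  where
  "is_module_hom S M N h \<longleftrightarrow>
     module S M \<and> module S N \<and> h \<in> hom (add_monoid M) (add_monoid N) \<and>
     (\<forall>r\<in>carrier S. \<forall>x\<in>carrier M. h (r \<odot>\<^bsub>M\<^esub> x) = r \<odot>\<^bsub>N\<^esub> h x)"

definition is_direct_summand ::
  "'b set \<Rightarrow> ('a, 'm) ring_scheme \<Rightarrow> ('a, 'b, 'p) module_scheme \<Rightarrow> bool" where
  "is_direct_summand N S M \<longleftrightarrow>
     module S M \<and> submodule N S M \<and>
     (\<exists>N'. submodule N' S M \<and> N \<inter> N' = {\<zero>\<^bsub>M\<^esub>} \<and> N <+>\<^bsub>M\<^esub> N' = carrier M)"

definition subalgebra_gen :: "'l::field set \<Rightarrow> 'l set \<Rightarrow> 'l set" where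
  "subalgebra_gen K S = generate_ring ring_of_type_algebra (K \<union> S)"

definition localize :: "'l::field set \<Rightarrow> 'l \<Rightarrow> 'l set" where
  "localize B c = subalgebra_gen B {inverse c}"

definition has_Quot_UNIV :: "'l::field set \<Rightarrow> bool" where
  "has_Quot_UNIV B \<longleftrightarrow> (\<forall>x. \<exists>p\<in>B. \<exists>q\<in>B. q \<noteq> 0 \<and> x = p / q)"

definition acts_by_automorphisms ::
  "('g, 'm) monoid_scheme \<Rightarrow> ('g \<Rightarrow> 'l \<Rightarrow> 'l::field) \<Rightarrow> bool" where
  "acts_by_automorphisms G act \<longleftrightarrow>
     group_action G UNIV act \<and>
     (\<forall>g\<in>carrier G. act g \<in> ring_iso ring_of_type_algebra ring_of_type_algebra)"

definition fixed :: "('g, 'm) monoid_scheme \<Rightarrow> ('g \<Rightarrow> 'l \<Rightarrow> 'l) \<Rightarrow> 'l set \<Rightarrow> 'l set" where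
  "fixed G act S = {x \<in> S. \<forall>g\<in>carrier G. act g x = x}"

definition G_stable :: "('g, 'm) monoid_scheme \<Rightarrow> ('g \<Rightarrow> 'x \<Rightarrow> 'x) \<Rightarrow> 'x set \<Rightarrow> bool" where
  "G_stable G act S \<longleftrightarrow> (\<forall>g\<in>carrier G. \<forall>x\<in>S. act g x \<in> S)"

text \<open>A monomial is its exponent vector, and multiplication of monomials is addition of exponent
  vectors. The polynomial type has countably many variables; the ring in \<open>n\<close> variables
  \<open>y\<^sub>0, \<dots>, y\<^sub>n\<^sub>-\<^sub>1\<close> is cut out by its carrier.\<close>

type_synonym monom = "nat \<Rightarrow>\<^sub>0 nat"
type_synonym 'l mpoly = "monom \<Rightarrow>\<^sub>0 'l"

definition monoms :: "nat \<Rightarrow> monom set" where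
  "monoms n = {m. Poly_Mapping.keys m \<subseteq> {..<n}}"

definition polys :: "nat \<Rightarrow> 'l::comm_ring_1 set \<Rightarrow> 'l mpoly set" where
  "polys n K = {f. Poly_Mapping.keys f \<subseteq> monoms n \<and>
     (\<forall>m\<in>Poly_Mapping.keys f. Poly_Mapping.lookup f m \<in> K)}"

abbreviation poly_ring :: "nat \<Rightarrow> 'l::comm_ring_1 mpoly ring" where
  "poly_ring n \<equiv> sub_ring (polys n UNIV)"

definition var_poly :: "nat \<Rightarrow> 'l::comm_ring_1 mpoly" where
  "var_poly i = Poly_Mapping.single (Poly_Mapping.single i 1) 1"

definition const_poly :: "'l::comm_ring_1 \<Rightarrow> 'l mpoly" where
  "const_poly x = Poly_Mapping.single 0 x"

definition eval_poly :: "(nat \<Rightarrow> 'l::comm_ring_1) \<Rightarrow> 'l mpoly \<Rightarrow> 'l" where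
  "eval_poly a f =
     (\<Sum>m\<in>Poly_Mapping.keys f. Poly_Mapping.lookup f m *
        (\<Prod>i\<in>Poly_Mapping.keys m. a i ^ Poly_Mapping.lookup m i))"

definition coeffs_of :: "'l::comm_ring_1 mpoly set \<Rightarrow> 'l set" where
  "coeffs_of S = {Poly_Mapping.lookup f m | f m. f \<in> S}"

definition Derksen_ideal ::
  "('g, 'm) monoid_scheme \<Rightarrow> ('g \<Rightarrow> 'l \<Rightarrow> 'l::field) \<Rightarrow> nat \<Rightarrow> (nat \<Rightarrow> 'l) \<Rightarrow> 'l mpoly set" where
  "Derksen_ideal G act n a =
     (\<Inter>g\<in>carrier G. Idl\<^bsub>poly_ring n\<^esub> ((\<lambda>i. var_poly i - const_poly (act g (a i))) ` {..<n}))"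

definition extended_Derksen_ideal ::
  "('g, 'm) monoid_scheme \<Rightarrow> ('g \<Rightarrow> 'l \<Rightarrow> 'l::field) \<Rightarrow> nat \<Rightarrow> (nat \<Rightarrow> 'l) \<Rightarrow> 'l mpoly set \<Rightarrow> bool"
  where
  "extended_Derksen_ideal G act n a E \<longleftrightarrow>
     ideal E (poly_ring n) \<and> E \<noteq> carrier (poly_ring n) \<and>
     G_stable G (\<lambda>g. Poly_Mapping.map (act g)) E \<and>
     Derksen_ideal G act n a \<subseteq> E"

text \<open>\<open>(s, t) \<in> mo\<close> means \<open>s \<le> t\<close>.\<close>

definition monomial_ordering :: "nat \<Rightarrow> monom rel \<Rightarrow> bool" where
  "monomial_ordering n mo \<longleftrightarrow>
     linear_order_on (monoms n) mo \<and>
     (\<forall>t\<in>monoms n. (0, t) \<in> mo) \<and>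
     (\<forall>s t. \<forall>u\<in>monoms n. (s, t) \<in> mo \<longrightarrow> (s + u, t + u) \<in> mo)"

text \<open>Only meaningful for nonzero \<open>f\<close>.\<close>

definition lead_monom :: "monom rel \<Rightarrow> 'l::comm_ring_1 mpoly \<Rightarrow> monom" where
  "lead_monom mo f = (THE m. m \<in> Poly_Mapping.keys f \<and> (\<forall>k\<in>Poly_Mapping.keys f. (k, m) \<in> mo))"

definition leading_ideal :: "nat \<Rightarrow> monom rel \<Rightarrow> 'l::comm_ring_1 mpoly set \<Rightarrow> 'l mpoly set" where
  "leading_ideal n mo S =
     Idl\<^bsub>poly_ring n\<^esub> {Poly_Mapping.single (lead_monom mo f) 1 | f. f \<in> S \<and> f \<noteq> 0}"

definition Groebner_basis ::
  "nat \<Rightarrow> monom rel \<Rightarrow> 'l::comm_ring_1 mpoly set \<Rightarrow> 'l mpoly set \<Rightarrow> bool" where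
  "Groebner_basis n mo E \<G> \<longleftrightarrow>
     finite \<G> \<and> \<G> \<subseteq> E \<and> leading_ideal n mo \<G> = leading_ideal n mo E"

definition reduced_Groebner_basis ::
  "nat \<Rightarrow> monom rel \<Rightarrow> 'l::comm_ring_1 mpoly set \<Rightarrow> 'l mpoly set \<Rightarrow> bool" where
  "reduced_Groebner_basis n mo E \<G> \<longleftrightarrow>
     Groebner_basis n mo E \<G> \<and>
     (\<forall>g\<in>\<G>. g \<noteq> 0 \<and> Poly_Mapping.lookup g (lead_monom mo g) = 1 \<and>
        (\<forall>m\<in>Poly_Mapping.keys g. Poly_Mapping.single m 1 \<notin> leading_ideal n mo (\<G> - {g})))"

text \<open>The normal form of \<open>f\<close> is the polynomial congruent to \<open>f\<close> modulo \<open>\<G>\<close> none of whose monomials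
  lies in the leading ideal of \<open>\<G>\<close>, i.e. is divisible by a leading monomial of \<open>\<G>\<close>; it exists uniquely when \<open>\<G>\<close> is a Groebner basis.\<close>

definition NF :: "nat \<Rightarrow> monom rel \<Rightarrow> 'l::comm_ring_1 mpoly set \<Rightarrow> 'l mpoly \<Rightarrow> 'l mpoly" where
  "NF n mo \<G> f =
     (THE r. r \<in> polys n UNIV \<and> f - r \<in> Idl\<^bsub>poly_ring n\<^esub> \<G> \<and>
        (\<forall>m\<in>Poly_Mapping.keys r. Poly_Mapping.single m 1 \<notin> leading_ideal n mo \<G>))"

definition invariantization_rel ::
  "nat \<Rightarrow> monom rel \<Rightarrow> 'l::field set \<Rightarrow> (nat \<Rightarrow> 'l) \<Rightarrow> 'l mpoly set \<Rightarrow> 'l \<Rightarrow> 'l \<Rightarrow> bool" where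
  "invariantization_rel n mo K a \<G> b v \<longleftrightarrow>
     (\<exists>f\<in>polys n K. b = eval_poly a f \<and> v = eval_poly (\<lambda>_. 0) (NF n mo \<G> f))"

definition invariantization ::
  "nat \<Rightarrow> monom rel \<Rightarrow> 'l::field set \<Rightarrow> (nat \<Rightarrow> 'l) \<Rightarrow> 'l mpoly set \<Rightarrow> 'l \<Rightarrow> 'l" where
  "invariantization n mo K a \<G> b = (THE v. invariantization_rel n mo K a \<G> b v)"

end

theory Submission
  imports Defs
begin

text \<open>
  For \<open>b = f(a)\<close> in \<open>R\<close> with \<open>f\<close> over \<open>K\<close>, the invariantization of \<open>b\<close> is the constant term of the
  normal form of \<open>f\<close> modulo \<open>E\<close>. Everything rests on one observation
  (\<open>in_E_if_value_invariant\<close>). Since \<open>K\<close> is fixed by the group, \<open>f\<close> takes the value \<open>\<sigma>(f(a))\<close> at the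
  translated point \<open>\<sigma> a\<close>. If \<open>f(a)\<close> is invariant, \<open>f - f(a)\<close> thus vanishes on the whole orbit of
  \<open>a\<close>, hence lies in the Derksen ideal and so in \<open>E\<close>.

  Three consequences follow. Two representatives of the same element differ by a polynomial with value
  \<open>0\<close>, hence by an element of \<open>E\<close>, so they have the same normal form and the map is well defined
  (\<open>NF_eq_if_value_eq\<close>). If \<open>s = h(a)\<close> is invariant, \<open>h f\<close> and \<open>s f\<close> agree modulo \<open>E\<close>, and
  normal forms are linear over the field \<open>L\<close>, so the map is linear over the ring of invariants
  (\<open>invariantization_linear\<close>). As \<open>E\<close> is proper, the normal form of \<open>1\<close> is \<open>1\<close>, so by linearity the
  map is the identity on invariants.

  That the values lie in \<open>A\<close> is a property of the division algorithm
  (\<open>normal_form_single\<close>): the basis is monic, so reducing a polynomial over \<open>K\<close> only adds and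
  multiplies coefficients of the polynomial and of the basis. Division terminates because monomial
  orderings are well-founded, by Dickson's lemma.

  After inverting a nonzero invariant \<open>c\<close> with \<open>R\<^sup>G\<^sub>c = A\<^sub>c\<close>, the formula
  \<open>\<psi>(x) = \<phi>(c\<^sup>k x) / c\<^sup>k\<close>, for any \<open>k\<close> that clears the denominator of \<open>x\<close>, is forced by linearity
  and does define an extension with values in \<open>A\<^sub>c\<close>. It is a projection onto \<open>R\<^sup>G\<^sub>c\<close>, and its kernel is
  a complement.
\<close>

section \<open>Subrings and ideals of a ring given by type classes\<close>

lemma ring_of_type_algebra_simps [simp]:
  "carrier ring_of_type_algebra = UNIV"
  "x \<otimes>\<^bsub>ring_of_type_algebra\<^esub> y = x * y"
  "\<one>\<^bsub>ring_of_type_algebra\<^esub> = 1"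
  "\<zero>\<^bsub>ring_of_type_algebra\<^esub> = 0"
  "x \<oplus>\<^bsub>ring_of_type_algebra\<^esub> y = x + y"
  by (simp_all add: ring_of_type_algebra_def)

lemma a_inv_ring_of_type_algebra [simp]:
  "\<ominus>\<^bsub>ring_of_type_algebra\<^esub> x = - (x :: 'a::comm_ring_1)"
proof -
  interpret ring "ring_of_type_algebra :: 'a ring" ..
  show ?thesis by (rule minus_equality) auto
qed

lemma subring_type_iff:
  fixes B :: "'a::comm_ring_1 set"
  shows "subring B ring_of_type_algebra \<longleftrightarrow>
    1 \<in> B \<and> (\<forall>x\<in>B. - x \<in> B) \<and> (\<forall>x\<in>B. \<forall>y\<in>B. x + y \<in> B \<and> x * y \<in> B)"
proof -
  interpret ring "ring_of_type_algebra :: 'a ring" ..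
  show ?thesis
    using subringE(3,5-7)[of B "ring_of_type_algebra :: 'a ring"] by (auto intro!: subringI)
qed

context
  fixes B :: "'a::comm_ring_1 set"
  assumes B: "subring B ring_of_type_algebra"
begin

lemma subring_closed:
  "1 \<in> B" "x \<in> B \<Longrightarrow> - x \<in> B" "x \<in> B \<Longrightarrow> y \<in> B \<Longrightarrow> x + y \<in> B"
  "x \<in> B \<Longrightarrow> y \<in> B \<Longrightarrow> x * y \<in> B"
  using B by (auto simp: subring_type_iff)

lemma subring_zero: "0 \<in> B"
  using subring_closed(3)[OF subring_closed(1) subring_closed(2)[OF subring_closed(1)]] by simp

lemma subring_diff: "x \<in> B \<Longrightarrow> y \<in> B \<Longrightarrow> x - y \<in> B"
  using subring_closed(2,3) by (metis add_uminus_conv_diff)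

lemma subring_power: "x \<in> B \<Longrightarrow> x ^ k \<in> B"
  by (induction k) (auto intro: subring_closed)

lemma cring_sub_ring: "cring (sub_ring B)"
proof -
  interpret cring "ring_of_type_algebra :: 'a ring" ..
  show ?thesis
    using subcring_iff[of B] subcringI'[OF B] by simp
qed

lemma ideal_sub_ring_iff:
  "ideal I (sub_ring B) \<longleftrightarrow>
     I \<subseteq> B \<and> 0 \<in> I \<and> (\<forall>x\<in>I. \<forall>y\<in>I. x + y \<in> I) \<and> (\<forall>x\<in>I. \<forall>b\<in>B. b * x \<in> I)"
proof
  assume "ideal I (sub_ring B)"
  then interpret I: ideal I "sub_ring B" .
  show "I \<subseteq> B \<and> 0 \<in> I \<and> (\<forall>x\<in>I. \<forall>y\<in>I. x + y \<in> I) \<and> (\<forall>x\<in>I. \<forall>b\<in>B. b * x \<in> I)"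
    using I.a_subset additive_subgroup.zero_closed[OF I.additive_subgroup_axioms]
      additive_subgroup.a_closed[OF I.additive_subgroup_axioms] I.I_l_closed by auto
next
  assume I: "I \<subseteq> B \<and> 0 \<in> I \<and> (\<forall>x\<in>I. \<forall>y\<in>I. x + y \<in> I) \<and> (\<forall>x\<in>I. \<forall>b\<in>B. b * x \<in> I)"
  interpret cring "sub_ring B" by (rule cring_sub_ring)
  have inv: "\<ominus>\<^bsub>sub_ring B\<^esub> x = - x" if "x \<in> B" for x
    by (rule minus_equality) (use that subring_closed in auto)
  have neg: "- x \<in> I" if "x \<in> I" for x
    using I that subring_closed(2)[OF subring_closed(1)] by (metis mult_minus1)
  show "ideal I (sub_ring B)"
  proof (rule idealI[OF ring_axioms])
    show "subgroup I (add_monoid (sub_ring B))"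
      by (rule add.subgroupI) (use I neg inv in \<open>auto simp: a_inv_def[symmetric]\<close>)
  qed (use I in \<open>auto simp: mult.commute\<close>)
qed

end

lemma subring_subalgebra_gen:
  "subring (subalgebra_gen K S) ring_of_type_algebra"
proof -
  interpret ring "ring_of_type_algebra :: 'a ring" ..
  show ?thesis unfolding subalgebra_gen_def by (rule generate_ring_is_subring) auto
qed

lemma subalgebra_gen_incl: "K \<subseteq> subalgebra_gen K S" "S \<subseteq> subalgebra_gen K S"
  unfolding subalgebra_gen_def by (auto intro: generate_ring.incl)

lemma subalgebra_gen_minimal:
  assumes "subring B ring_of_type_algebra" "K \<subseteq> B" "S \<subseteq> B"
  shows "subalgebra_gen K S \<subseteq> B"
proof -
  interpret ring "ring_of_type_algebra :: 'a ring" ..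
  show ?thesis unfolding subalgebra_gen_def
    by (rule generate_ring_min_subring1) (use assms in auto)
qed


section \<open>Polynomials with coefficients in a subring\<close>

lemma poly_eq_sum_single:
  "f = (\<Sum>m\<in>Poly_Mapping.keys f. Poly_Mapping.single m (Poly_Mapping.lookup f m))"
  by (rule poly_mapping_eqI)
    (simp add: lookup_sum lookup_single when_def in_keys_iff)

lemma poly_mult_eq_sum:
  fixes f g :: "'l::comm_ring_1 mpoly"
  shows "f * g = (\<Sum>s\<in>Poly_Mapping.keys f. \<Sum>t\<in>Poly_Mapping.keys g.
    Poly_Mapping.single (s + t) (Poly_Mapping.lookup f s * Poly_Mapping.lookup g t))"
  by (subst poly_eq_sum_single[of f], subst poly_eq_sum_single[of g])
    (simp add: sum_product mult_single)

lemma zero_in_monoms: "0 \<in> monoms n"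
  by (simp add: monoms_def)

lemma add_in_monoms: "s \<in> monoms n \<Longrightarrow> t \<in> monoms n \<Longrightarrow> s + t \<in> monoms n"
  using keys_add[of s t] by (auto simp: monoms_def)

lemma polys_mono: "B \<subseteq> C \<Longrightarrow> polys n B \<subseteq> polys n C"
  by (auto simp: polys_def)

lemma single_in_polys: "m \<in> monoms n \<Longrightarrow> c \<in> B \<Longrightarrow> Poly_Mapping.single m c \<in> polys n B"
  by (auto simp: polys_def)

lemma const_in_polys: "c \<in> B \<Longrightarrow> const_poly c \<in> polys n B"
  by (simp add: const_poly_def single_in_polys zero_in_monoms)

lemma subring_polys:
  fixes B :: "'a::comm_ring_1 set"
  assumes B: "subring B ring_of_type_algebra"
  shows "subring (polys n B) ring_of_type_algebra"
proof -
  have add: "f + g \<in> polys n B" if "f \<in> polys n B" "g \<in> polys n B" for f g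
  proof -
    have "Poly_Mapping.lookup f m \<in> B" "Poly_Mapping.lookup g m \<in> B" for m
      using that subring_zero[OF B]
      by (cases "Poly_Mapping.lookup f m = 0"; cases "Poly_Mapping.lookup g m = 0";
          force simp: polys_def in_keys_iff)+
    then show ?thesis
      using that keys_add[of f g] by (auto simp: polys_def lookup_add subring_closed[OF B])
  qed
  have zero: "0 \<in> polys n B"
    by (simp add: polys_def)
  have sum: "sum F I \<in> polys n B" if "\<And>i. i \<in> I \<Longrightarrow> F i \<in> polys n B" for F :: "monom \<Rightarrow> _" and I
    using that by (induction I rule: infinite_finite_induct) (auto intro: add zero)
  have "f * g \<in> polys n B" if "f \<in> polys n B" "g \<in> polys n B" for f g
    unfolding poly_mult_eq_sum[of f g] using that
    by (intro sum single_in_polys add_in_monoms subring_closed[OF B]) (auto simp: polys_def)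
  moreover have "1 \<in> polys n B"
    using const_in_polys[OF subring_closed(1)[OF B]] by (simp add: const_poly_def)
  moreover have "- f \<in> polys n B" if "f \<in> polys n B" for f
    using that by (auto simp: polys_def subring_closed[OF B] in_keys_iff)
  ultimately show ?thesis
    using add by (auto simp: subring_type_iff)
qed

lemma var_in_polys: "i < n \<Longrightarrow> 1 \<in> B \<Longrightarrow> var_poly i \<in> polys n B"
  by (simp add: var_poly_def single_in_polys monoms_def)

lemma single_eq_prod_vars:
  "Poly_Mapping.single m (1 :: 'a::comm_ring_1) =
     (\<Prod>i\<in>Poly_Mapping.keys m. var_poly i ^ Poly_Mapping.lookup m i)"
proof -
  have power: "Poly_Mapping.single (Poly_Mapping.single i k) (1::'a) = var_poly i ^ k" for i k
  proof (induction k)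
    case (Suc k)
    have *: "Poly_Mapping.single i (Suc k) = Poly_Mapping.single i 1 + Poly_Mapping.single i k"
      by (simp flip: single_add)
    show ?case by (simp add: * flip: Suc) (simp add: var_poly_def mult_single)
  qed simp
  have prod: "Poly_Mapping.single (sum F I) (1::'a) = (\<Prod>i\<in>I. Poly_Mapping.single (F i) 1)"
    for F :: "nat \<Rightarrow> monom" and I
  proof (induction I rule: infinite_finite_induct)
    case (insert i I)
    then show ?case by (simp add: mult_single flip: insert.IH)
  qed simp_all
  show ?thesis
    by (subst (1) poly_eq_sum_single[of m]) (simp add: prod power)
qed

text \<open>The polynomial ring over \<open>B\<close> is generated by the constants and the variables. The statements
  below about values of polynomials are compatible with sums and products, so it suffices to check them
  on these generators.\<close>
lemma polys_induct [consumes 2, case_names const var add mult]: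
  fixes B :: "'a::comm_ring_1 set"
  assumes B: "subring B ring_of_type_algebra" and f: "f \<in> polys n B"
    and const: "\<And>c. c \<in> B \<Longrightarrow> P (const_poly c)"
    and var: "\<And>i. i < n \<Longrightarrow> P (var_poly i)"
    and add: "\<And>f g. f \<in> polys n B \<Longrightarrow> g \<in> polys n B \<Longrightarrow> P f \<Longrightarrow> P g \<Longrightarrow> P (f + g)"
    and mult: "\<And>f g. f \<in> polys n B \<Longrightarrow> g \<in> polys n B \<Longrightarrow> P f \<Longrightarrow> P g \<Longrightarrow> P (f * g)"
  shows "P f"
proof -
  define S where "S = {f \<in> polys n B. P f}"
  have P0: "0 \<in> S" and P1: "1 \<in> S"
    using const[OF subring_zero[OF B]] const[OF subring_closed(1)[OF B]]
      subring_zero[OF subring_polys[OF B]] subring_closed(1)[OF subring_polys[OF B]]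
    by (auto simp: const_poly_def S_def)
  have S: "f + g \<in> S" "f * g \<in> S" if "f \<in> S" "g \<in> S" for f g
    using that add mult subring_closed[OF subring_polys[OF B]] by (auto simp: S_def)
  have power: "f ^ k \<in> S" if "f \<in> S" for f k
    using that by (induction k) (auto intro: P1 S)
  have prod: "prod F I \<in> S" if "\<And>i. i \<in> I \<Longrightarrow> F i \<in> S" for F :: "nat \<Rightarrow> _" and I
    using that by (induction I rule: infinite_finite_induct) (auto intro: P1 S)
  have sum: "sum F I \<in> S" if "\<And>i. i \<in> I \<Longrightarrow> F i \<in> S" for F :: "monom \<Rightarrow> _" and I
    using that by (induction I rule: infinite_finite_induct) (auto intro: P0 S)
  have single: "Poly_Mapping.single m c \<in> S" if "m \<in> monoms n" "c \<in> B" for m c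
  proof -
    have "Poly_Mapping.single m 1 \<in> S"
      unfolding single_eq_prod_vars using that var subring_closed(1)[OF B]
      by (intro prod power) (auto simp: monoms_def S_def intro: var_in_polys)
    moreover have "const_poly c \<in> S"
      using that by (auto simp: S_def const const_in_polys)
    ultimately have "const_poly c * Poly_Mapping.single m 1 \<in> S"
      by (rule S(2)[rotated])
    then show ?thesis by (simp add: const_poly_def mult_single)
  qed
  have "f \<in> S"
    by (subst poly_eq_sum_single) (use f in \<open>auto simp: polys_def intro!: sum single\<close>)
  then show ?thesis by (simp add: S_def)
qed


section \<open>Evaluation\<close>

definition eval_monom :: "(nat \<Rightarrow> 'l::comm_ring_1) \<Rightarrow> monom \<Rightarrow> 'l" where
  "eval_monom p m = (\<Prod>i\<in>Poly_Mapping.keys m. p i ^ Poly_Mapping.lookup m i)"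

lemma eval_monom_superset:
  assumes "finite I" "Poly_Mapping.keys m \<subseteq> I"
  shows "eval_monom p m = (\<Prod>i\<in>I. p i ^ Poly_Mapping.lookup m i)"
  unfolding eval_monom_def
  by (rule prod.mono_neutral_left) (use assms in \<open>auto simp: in_keys_iff\<close>)

lemma eval_monom_add: "eval_monom p (s + t) = eval_monom p s * eval_monom p t"
proof -
  let ?I = "Poly_Mapping.keys s \<union> Poly_Mapping.keys t"
  show ?thesis
    using keys_add[of s t]
    by (simp add: eval_monom_superset[of ?I] lookup_add power_add prod.distrib)
qed

lemma eval_poly_superset:
  assumes "finite S" "Poly_Mapping.keys f \<subseteq> S"
  shows "eval_poly p f = (\<Sum>m\<in>S. Poly_Mapping.lookup f m * eval_monom p m)"
  unfolding eval_poly_def eval_monom_def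
  by (rule sum.mono_neutral_left) (use assms in \<open>auto simp: in_keys_iff\<close>)

lemma eval_poly_zero [simp]: "eval_poly p 0 = 0"
  by (simp add: eval_poly_def)

lemma eval_poly_add: "eval_poly p (f + g) = eval_poly p f + eval_poly p g"
proof -
  let ?S = "Poly_Mapping.keys f \<union> Poly_Mapping.keys g"
  show ?thesis
    using keys_add[of f g]
    by (simp add: eval_poly_superset[of ?S] lookup_add distrib_right sum.distrib)
qed

lemma eval_poly_sum: "eval_poly p (sum F I) = (\<Sum>i\<in>I. eval_poly p (F i))"
  by (induction I rule: infinite_finite_induct) (auto simp: eval_poly_add)

lemma eval_poly_single: "eval_poly p (Poly_Mapping.single m c) = c * eval_monom p m"
  by (subst eval_poly_superset[of "{m}"]) auto

lemma eval_poly_const [simp]: "eval_poly p (const_poly c) = c"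
  by (simp add: const_poly_def eval_poly_single eval_monom_def)

lemma eval_poly_var [simp]: "eval_poly p (var_poly i) = p i"
  by (simp add: var_poly_def eval_poly_single eval_monom_def)

lemma eval_poly_mult: "eval_poly p (f * g) = eval_poly p f * eval_poly p g"
proof -
  show ?thesis
    by (simp add: poly_mult_eq_sum[of f g] eval_poly_sum eval_poly_single eval_monom_add eval_poly_superset[OF _ order_refl]
        sum_product mult_ac)
qed

lemma eval_poly_minus: "eval_poly p (- f) = - eval_poly p f"
  using eval_poly_add[of p f "- f"] by (simp add: eq_neg_iff_add_eq_0 add.commute)

lemma eval_poly_diff: "eval_poly p (f - g) = eval_poly p f - eval_poly p g"
  using eval_poly_add[of p f "- g"] by (simp add: eval_poly_minus)

lemma eval_poly_at_zero_in_subring: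
  assumes B: "subring B ring_of_type_algebra" and f: "f \<in> polys n B"
  shows "eval_poly (\<lambda>_. 0) f \<in> B"
  using B f
proof (induction rule: polys_induct)
  case (const c) then show ?case by simp
next
  case (var i) then show ?case by (simp add: subring_zero[OF B])
qed (simp_all add: eval_poly_add eval_poly_mult subring_closed[OF B])

lemma subalgebra_gen_eq_eval:
  assumes K: "subring K ring_of_type_algebra"
  shows "subalgebra_gen K (a ` {..<n}) = eval_poly a ` polys n K"
proof
  note PK = subring_closed[OF subring_polys[OF K, of n]]
  have sub: "subring (eval_poly a ` polys n K) ring_of_type_algebra"
    unfolding subring_type_iff
  proof (intro conjI ballI; (elim imageE)?; (simp only:)?)
    show "1 \<in> eval_poly a ` polys n K"
      using const_in_polys[OF subring_closed(1)[OF K]] eval_poly_const by (metis imageI)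
  qed (auto simp: PK simp flip: eval_poly_minus eval_poly_add eval_poly_mult)
  show "subalgebra_gen K (a ` {..<n}) \<subseteq> eval_poly a ` polys n K"
  proof (rule subalgebra_gen_minimal[OF sub])
    show "K \<subseteq> eval_poly a ` polys n K"
      using const_in_polys eval_poly_const by (metis imageI subsetI)
    show "a ` {..<n} \<subseteq> eval_poly a ` polys n K"
      using var_in_polys subring_closed(1)[OF K] eval_poly_var
      by (metis image_subset_iff lessThan_iff imageI)
  qed
  have "eval_poly a f \<in> subalgebra_gen K (a ` {..<n})" if "f \<in> polys n K" for f
    using K that
  proof (induction rule: polys_induct)
    case (const c) then show ?case using subalgebra_gen_incl(1)[of K] by auto
  next
    case (var i) then show ?case using subalgebra_gen_incl(2)[of "a ` {..<n}" K] by auto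
  next
    case (add f g) then show ?case
      by (simp add: eval_poly_add subring_closed[OF subring_subalgebra_gen])
  next
    case (mult f g) then show ?case
      by (simp add: eval_poly_mult subring_closed[OF subring_subalgebra_gen])
  qed
  then show "eval_poly a ` polys n K \<subseteq> subalgebra_gen K (a ` {..<n})" by blast
qed


section \<open>Monomial orderings are well-founded\<close>

text \<open>If the monotone subsequence happens to be decreasing, it is constant from the point where it attains
  its minimum.\<close>
lemma nat_seq_incseq_subseq:
  fixes s :: "nat \<Rightarrow> nat"
  shows "\<exists>h. strict_mono h \<and> incseq (\<lambda>k. s (h k))"
proof -
  obtain h where h: "strict_mono h" "monoseq (\<lambda>k. s (h k))"
    using seq_monosub by blast
  show ?thesis
  proof (cases "incseq (\<lambda>k. s (h k))")
    case False
    then have dec: "decseq (\<lambda>k. s (h k))"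
      using h(2) by (simp add: monoseq_iff)
    obtain N where N: "\<And>k. s (h N) \<le> s (h k)"
      using ex_has_least_nat[of "\<lambda>_. True" 0 "\<lambda>k. s (h k)"] by auto
    have "s (h (k + N)) = s (h N)" for k
      using N[of "k + N"] decseqD[OF dec, of N "k + N"] by simp
    then have "incseq (\<lambda>k. s (h (k + N)))" by (simp add: incseq_def)
    moreover have "strict_mono (\<lambda>k. h (k + N))"
      using h(1) by (simp add: strict_mono_def)
    ultimately show ?thesis by blast
  qed (use h in blast)
qed

text \<open>Induction on the number of variables: a further passage to a subsequence keeps the earlier exponents
  nondecreasing.\<close>
lemma exponents_incseq_subseq:
  fixes f :: "nat \<Rightarrow> monom"
  shows "\<exists>h. strict_mono h \<and> (\<forall>i<n. incseq (\<lambda>k. Poly_Mapping.lookup (f (h k)) i))"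
proof (induction n)
  case 0
  have "strict_mono (id :: nat \<Rightarrow> nat)" by (simp add: strict_mono_def)
  then show ?case by blast
next
  case (Suc n)
  then obtain h where h: "strict_mono h"
    "\<And>i. i < n \<Longrightarrow> incseq (\<lambda>k. Poly_Mapping.lookup (f (h k)) i)" by blast
  obtain h' where h': "strict_mono h'" "incseq (\<lambda>k. Poly_Mapping.lookup (f (h (h' k))) n)"
    using nat_seq_incseq_subseq[of "\<lambda>k. Poly_Mapping.lookup (f (h k)) n"] by blast
  have "strict_mono (\<lambda>k. h (h' k))"
    using h(1) h'(1) by (simp add: strict_mono_def)
  moreover have "incseq (\<lambda>k. Poly_Mapping.lookup (f (h (h' k))) i)" if "i < Suc n" for i
  proof (cases "i = n")
    case False
    then have "incseq (\<lambda>k. Poly_Mapping.lookup (f (h k)) i)" using h(2) that by simp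
    then show ?thesis
      using strict_mono_less_eq[OF h'(1)] by (simp add: incseq_def)
  qed (use h' in simp)
  ultimately show ?case by blast
qed

text \<open>Dickson's lemma in the form in which it gives termination: among infinitely many monomials, one
  divides a later one. Passing to a subsequence once for each variable makes all the exponents
  nondecreasing, and then any two terms of the subsequence will do.\<close>
lemma Dickson:
  fixes f :: "nat \<Rightarrow> monom"
  assumes "\<And>i. f i \<in> monoms n"
  obtains i j u where "i < j" "u \<in> monoms n" "f j = f i + u"
proof -
  obtain h where h: "strict_mono h"
    "\<And>i. i < n \<Longrightarrow> incseq (\<lambda>k. Poly_Mapping.lookup (f (h k)) i)"
    using exponents_incseq_subseq by blast
  have le: "Poly_Mapping.lookup (f (h 0)) i \<le> Poly_Mapping.lookup (f (h 1)) i" for i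
  proof (cases "i < n")
    case True
    then show ?thesis using h(2) by (simp add: incseq_def)
  next
    case False
    then have "i \<notin> Poly_Mapping.keys (f (h 0))" using assms[of "h 0"] by (auto simp: monoms_def)
    then show ?thesis by (simp add: in_keys_iff)
  qed
  show ?thesis
  proof
    show "h 0 < h 1" using h(1) by (simp add: strict_mono_def)
    show "f (h 1) = f (h 0) + (f (h 1) - f (h 0))"
      by (rule poly_mapping_eqI) (use le in \<open>simp add: lookup_add lookup_minus\<close>)
    show "f (h 1) - f (h 0) \<in> monoms n"
    proof -
      have "Poly_Mapping.keys (f (h 1) - f (h 0)) \<subseteq> Poly_Mapping.keys (f (h 1))"
        by (auto simp: in_keys_iff lookup_minus)
      then show ?thesis using assms[of "h 1"] by (simp add: monoms_def)
    qed
  qed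
qed

locale monomial_order =
  fixes n :: nat and mo :: "monom rel"
  assumes monomial_ordering: "monomial_ordering n mo"
begin

lemma order_facts:
  "trans mo" "antisym mo" "mo \<subseteq> monoms n \<times> monoms n" "total_on (monoms n) mo"
  "m \<in> monoms n \<Longrightarrow> (m, m) \<in> mo" "t \<in> monoms n \<Longrightarrow> (0, t) \<in> mo"
  "(s, t) \<in> mo \<Longrightarrow> u \<in> monoms n \<Longrightarrow> (s + u, t + u) \<in> mo"
  using monomial_ordering
  by (auto simp: monomial_ordering_def order_on_defs refl_on_def)

text \<open>A divisor is below its multiples, because \<open>0\<close> is the least monomial and the ordering is
  compatible with multiplication. By Dickson's lemma, an infinite descending chain would contain a
  monomial that is at most a strictly smaller one.\<close>
lemma wf_strict: "wf (mo - Id)"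
  unfolding wf_iff_no_infinite_down_chain
proof
  assume "\<exists>f. \<forall>i. (f (Suc i), f i) \<in> mo - Id"
  then obtain f where f: "\<And>i. (f (Suc i), f i) \<in> mo - Id" by blast
  have fm: "f i \<in> monoms n" for i using f[of i] order_facts(3) by blast
  obtain i j u where ij: "i < j" "u \<in> monoms n" "f j = f i + u"
    using Dickson fm by blast
  have "(f i, f j) \<in> mo"
    using order_facts(7)[OF order_facts(6)[OF ij(2)] fm[of i]] ij(3) by (simp add: add.commute)
  have down: "(f (k + i'), f i') \<in> mo" for k i'
  proof (induction k)
    case (Suc k)
    then show ?case using f[of "k + i'"] order_facts(1) by (auto dest: transD)
  qed (simp add: order_facts(5) fm)
  have "(f j, f (Suc i)) \<in> mo"
    using down[of "j - Suc i" "Suc i"] ij(1) by simp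
  then have "(f i, f (Suc i)) \<in> mo"
    using \<open>(f i, f j) \<in> mo\<close> order_facts(1) by (auto dest: transD)
  then show False using f[of i] order_facts(2) by (auto dest: antisymD)
qed

lemma lead_monom_props:
  assumes "f \<in> polys n UNIV" "f \<noteq> 0"
  shows "lead_monom mo f \<in> Poly_Mapping.keys f"
    and "k \<in> Poly_Mapping.keys f \<Longrightarrow> (k, lead_monom mo f) \<in> mo"
proof -
  have "\<exists>m\<in>S. \<forall>k\<in>S. (k, m) \<in> mo" if "finite S" "S \<noteq> {}" "S \<subseteq> monoms n" for S
    using that
  proof (induction S rule: finite_ne_induct)
    case (singleton x)
    then show ?case using order_facts(5) by simp
  next
    case (insert x S)
    then obtain m where m: "m \<in> S" "\<forall>k\<in>S. (k, m) \<in> mo" by auto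
    have "(x, m) \<in> mo \<or> (m, x) \<in> mo"
      using order_facts(4,5) insert m by (metis insertCI subsetD total_on_def)
    then show ?case
    proof
      assume "(m, x) \<in> mo"
      then have "\<forall>k\<in>insert x S. (k, x) \<in> mo"
        using m order_facts(1,5) insert.prems by (auto dest: transD)
      then show ?case by blast
    qed (use m in auto)
  qed
  moreover have "Poly_Mapping.keys f \<noteq> {}" "Poly_Mapping.keys f \<subseteq> monoms n"
    using assms by (auto simp: polys_def)
  ultimately obtain m where m: "m \<in> Poly_Mapping.keys f" "\<forall>k\<in>Poly_Mapping.keys f. (k, m) \<in> mo"
    using finite_keys by meson
  then have "lead_monom mo f = m"
    unfolding lead_monom_def using order_facts(2) by (blast dest: antisymD)
  then show "lead_monom mo f \<in> Poly_Mapping.keys f"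
    and "k \<in> Poly_Mapping.keys f \<Longrightarrow> (k, lead_monom mo f) \<in> mo"
    using m by auto
qed

end


section \<open>Normal forms\<close>

lemma subring_polys_UNIV: "subring (polys n (UNIV :: 'a::comm_ring_1 set)) ring_of_type_algebra"
  by (rule subring_polys) (simp add: subring_type_iff)

lemmas poly_ring_ideal_iff = ideal_sub_ring_iff[OF subring_polys_UNIV]

lemma poly_ring_ideal_closed:
  assumes "ideal I (poly_ring n)"
  shows "0 \<in> I"
    and "f \<in> I \<Longrightarrow> g \<in> I \<Longrightarrow> f + g \<in> I"
    and "f \<in> I \<Longrightarrow> h \<in> polys n UNIV \<Longrightarrow> h * f \<in> I"
  using assms unfolding poly_ring_ideal_iff by blast+

lemma poly_ring_ideal_diff:
  assumes "ideal I (poly_ring n)" "f \<in> I" "g \<in> I"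
  shows "f - g \<in> I"
proof -
  have "(- 1) * g \<in> I"
    by (rule poly_ring_ideal_closed(3)[OF assms(1,3)])
      (intro subring_closed(1,2)[OF subring_polys_UNIV])
  from poly_ring_ideal_closed(2)[OF assms(1,2) this] show ?thesis by simp
qed

lemma poly_ring_genideal:
  fixes S :: "'a::comm_ring_1 mpoly set"
  assumes "S \<subseteq> polys n UNIV"
  shows "ideal (Idl\<^bsub>poly_ring n\<^esub> S) (poly_ring n)"
    and "S \<subseteq> Idl\<^bsub>poly_ring n\<^esub> S"
    and "ideal I (poly_ring n) \<Longrightarrow> S \<subseteq> I \<Longrightarrow> Idl\<^bsub>poly_ring n\<^esub> S \<subseteq> I"
proof -
  interpret cring "poly_ring n :: 'a mpoly ring"
    by (rule cring_sub_ring[OF subring_polys_UNIV])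
  show "ideal (Idl\<^bsub>poly_ring n\<^esub> S) (poly_ring n)"
    by (rule genideal_ideal) (use assms in simp)
  show "S \<subseteq> Idl\<^bsub>poly_ring n\<^esub> S"
    by (rule genideal_self) (use assms in simp)
  show "ideal I (poly_ring n) \<Longrightarrow> S \<subseteq> I \<Longrightarrow> Idl\<^bsub>poly_ring n\<^esub> S \<subseteq> I"
    by (rule genideal_minimal)
qed

text \<open>A monomial ideal contains a monomial only if one of the generating monomials divides it: the
  polynomials all of whose monomials are divisible by a generator already form an ideal.\<close>
lemma (in monomial_order) single_in_leading_ideal_iff:
  fixes S :: "'l::field mpoly set"
  assumes S: "S \<subseteq> polys n UNIV"
  shows "Poly_Mapping.single m 1 \<in> leading_ideal n mo S \<longleftrightarrow>
    (\<exists>f\<in>S. f \<noteq> 0 \<and> (\<exists>u\<in>monoms n. m = lead_monom mo f + u))"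
proof -
  let ?L = "{Poly_Mapping.single (lead_monom mo f) (1::'l) | f. f \<in> S \<and> f \<noteq> 0}"
  let ?D = "{m \<in> monoms n. \<exists>f\<in>S. f \<noteq> 0 \<and> (\<exists>u\<in>monoms n. m = lead_monom mo f + u)}"
  have lm: "lead_monom mo f \<in> monoms n" if "f \<in> S" "f \<noteq> 0" for f
    using lead_monom_props(1)[of f] that S by (auto simp: polys_def)
  have L: "?L \<subseteq> polys n UNIV"
    using lm by (auto intro: single_in_polys)
  note gen = poly_ring_genideal[OF L]
  have D: "u + m \<in> ?D" if "m \<in> ?D" "u \<in> monoms n" for m u
  proof -
    from that obtain f v where f: "f \<in> S" "f \<noteq> 0" "v \<in> monoms n" "m = lead_monom mo f + v"
      by blast
    then have "u + m = lead_monom mo f + (u + v)" by (simp add: ac_simps)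
    then show ?thesis using f that add_in_monoms by blast
  qed
  have "ideal {f :: 'l mpoly. Poly_Mapping.keys f \<subseteq> ?D} (poly_ring n)"
    unfolding poly_ring_ideal_iff
  proof (intro conjI ballI)
    fix f b :: "'l mpoly"
    assume "f \<in> {f. Poly_Mapping.keys f \<subseteq> ?D}" "b \<in> polys n UNIV"
    then have fb: "Poly_Mapping.keys f \<subseteq> ?D" "Poly_Mapping.keys b \<subseteq> monoms n"
      by (auto simp: polys_def)
    have "Poly_Mapping.keys (b * f) \<subseteq> ?D"
    proof
      fix k assume "k \<in> Poly_Mapping.keys (b * f)"
      then obtain u m where "k = u + m" "u \<in> Poly_Mapping.keys b" "m \<in> Poly_Mapping.keys f"
        using keys_mult[of b f] by blast
      then show "k \<in> ?D" using D[of m u] fb by blast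
    qed
    then show "b * f \<in> {f. Poly_Mapping.keys f \<subseteq> ?D}" by blast
  next
    fix f g :: "'l mpoly"
    assume "f \<in> {f. Poly_Mapping.keys f \<subseteq> ?D}" "g \<in> {f. Poly_Mapping.keys f \<subseteq> ?D}"
    then show "f + g \<in> {f. Poly_Mapping.keys f \<subseteq> ?D}"
      using keys_add[of f g] by blast
  qed (auto simp: polys_def)
  moreover have "?L \<subseteq> {f. Poly_Mapping.keys f \<subseteq> ?D}"
    using lm zero_in_monoms by fastforce
  ultimately have "leading_ideal n mo S \<subseteq> {f. Poly_Mapping.keys f \<subseteq> ?D}"
    unfolding leading_ideal_def by (rule gen(3))
  moreover have "Poly_Mapping.single (lead_monom mo f + u) 1 \<in> leading_ideal n mo S"
    if "f \<in> S" "f \<noteq> 0" "u \<in> monoms n" for f u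
  proof -
    have "Poly_Mapping.single (lead_monom mo f) 1 \<in> leading_ideal n mo S"
      unfolding leading_ideal_def using gen(2) that by blast
    moreover have "Poly_Mapping.single u 1 \<in> polys n UNIV"
      using that by (simp add: single_in_polys)
    ultimately have
      "Poly_Mapping.single u 1 * Poly_Mapping.single (lead_monom mo f) 1 \<in> leading_ideal n mo S"
      using poly_ring_ideal_closed(3)[OF gen(1)] unfolding leading_ideal_def by blast
    then show ?thesis by (simp add: mult_single add.commute)
  qed
  ultimately have "Poly_Mapping.single m 1 \<in> leading_ideal n mo S \<longleftrightarrow> m \<in> ?D"
    by (intro iffI) (force, blast)
  moreover have "m \<in> ?D \<longleftrightarrow> (\<exists>f\<in>S. f \<noteq> 0 \<and> (\<exists>u\<in>monoms n. m = lead_monom mo f + u))"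
    using lm add_in_monoms by blast
  ultimately show ?thesis by (rule trans)
qed

text \<open>
  The property that \<^const>\<open>NF\<close> selects by definite description. The normal form becomes
  accessible only once existence and uniqueness are known, so the division process is carried out with
  this relation.\<close>
definition is_normal_form ::
  "nat \<Rightarrow> monom rel \<Rightarrow> 'l::comm_ring_1 mpoly set \<Rightarrow> 'l mpoly \<Rightarrow> 'l mpoly \<Rightarrow> bool" where
  "is_normal_form n mo \<G> f r \<longleftrightarrow> r \<in> polys n UNIV \<and> f - r \<in> Idl\<^bsub>poly_ring n\<^esub> \<G> \<and>
     (\<forall>m\<in>Poly_Mapping.keys r. Poly_Mapping.single m 1 \<notin> leading_ideal n mo \<G>)"

lemma is_normal_form_add:
  fixes \<G> :: "'l::comm_ring_1 mpoly set"
  assumes "\<G> \<subseteq> polys n UNIV" "is_normal_form n mo \<G> f r" "is_normal_form n mo \<G> g s"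
  shows "is_normal_form n mo \<G> (f + g) (r + s)"
proof -
  have "(f - r) + (g - s) \<in> Idl\<^bsub>poly_ring n\<^esub> \<G>"
    using poly_ring_ideal_closed(2)[OF poly_ring_genideal(1)[OF assms(1)]] assms(2,3)
    unfolding is_normal_form_def by blast
  then have "(f + g) - (r + s) \<in> Idl\<^bsub>poly_ring n\<^esub> \<G>"
    by (simp add: algebra_simps)
  moreover have "r + s \<in> polys n UNIV"
    using assms(2,3) subring_closed(3)[OF subring_polys_UNIV] by (auto simp: is_normal_form_def)
  ultimately show ?thesis
    using assms(2,3) keys_add[of r s] unfolding is_normal_form_def by blast
qed

lemma keys_const_mult: "Poly_Mapping.keys (const_poly c * f) \<subseteq> Poly_Mapping.keys f"
  using keys_mult[of "const_poly c" f] by (auto simp: const_poly_def split: if_splits)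

lemma is_normal_form_const_mult:
  fixes \<G> :: "'l::comm_ring_1 mpoly set"
  assumes "\<G> \<subseteq> polys n UNIV" "is_normal_form n mo \<G> f r"
  shows "is_normal_form n mo \<G> (const_poly c * f) (const_poly c * r)"
proof -
  have "const_poly c * (f - r) \<in> Idl\<^bsub>poly_ring n\<^esub> \<G>"
    using poly_ring_ideal_closed(3)[OF poly_ring_genideal(1)[OF assms(1)]] assms(2)
      const_in_polys[of c UNIV]
    unfolding is_normal_form_def by blast
  moreover have "const_poly c * r \<in> polys n UNIV"
    using assms(2) subring_closed(4)[OF subring_polys_UNIV] const_in_polys[of c UNIV]
    by (auto simp: is_normal_form_def)
  ultimately show ?thesis
    using assms(2) keys_const_mult[of c r] unfolding is_normal_form_def
    by (auto simp: right_diff_distrib)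
qed

locale reduced_Groebner = monomial_order +
  fixes E \<G> :: "'l::field mpoly set"
  assumes ideal_E: "ideal E (poly_ring n)"
    and reduced: "reduced_Groebner_basis n mo E \<G>"
begin

lemma basis_facts:
  "\<G> \<subseteq> E" "leading_ideal n mo \<G> = leading_ideal n mo E"
  "g \<in> \<G> \<Longrightarrow> g \<noteq> 0" "g \<in> \<G> \<Longrightarrow> Poly_Mapping.lookup g (lead_monom mo g) = 1"
  using reduced by (auto simp: reduced_Groebner_basis_def Groebner_basis_def)

lemma E_subset: "E \<subseteq> polys n UNIV"
  using ideal_E by (simp add: poly_ring_ideal_iff)

lemma basis_subset: "\<G> \<subseteq> polys n UNIV"
  using basis_facts(1) E_subset by blast

lemma Idl_subset: "Idl\<^bsub>poly_ring n\<^esub> \<G> \<subseteq> E"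
  using poly_ring_genideal(3)[OF basis_subset ideal_E] basis_facts(1) by blast

text \<open>The leading monomial of a nonzero element of \<open>E\<close> lies in the leading ideal of \<open>E\<close>, which is that
  of the basis. This yields both the uniqueness of normal forms and the fact that the basis
  generates \<open>E\<close>.\<close>
lemma zero_if_irreducible:
  assumes "f \<in> E" "\<And>m. m \<in> Poly_Mapping.keys f \<Longrightarrow> Poly_Mapping.single m 1 \<notin> leading_ideal n mo \<G>"
  shows "f = 0"
proof (rule ccontr)
  assume "f \<noteq> 0"
  have "Poly_Mapping.single (lead_monom mo f) 1 \<in> leading_ideal n mo \<G>"
    using basis_facts(2) single_in_leading_ideal_iff[OF E_subset] zero_in_monoms[of n]
      \<open>f \<noteq> 0\<close> assms(1) by (metis add_0_right)
  moreover have "lead_monom mo f \<in> Poly_Mapping.keys f"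
    using lead_monom_props(1) \<open>f \<noteq> 0\<close> assms(1) E_subset by blast
  ultimately show False using assms(2) by blast
qed

lemma normal_form_sum:
  assumes A: "subring A ring_of_type_algebra"
    and F: "\<And>i. i \<in> S \<Longrightarrow> \<exists>r\<in>polys n A. is_normal_form n mo \<G> (F i) r"
  shows "\<exists>r\<in>polys n A. is_normal_form n mo \<G> (sum F S) r"
proof -
  note PA = subring_polys[OF A, of n]
  have zero: "\<exists>r\<in>polys n A. is_normal_form n mo \<G> 0 r"
  proof
    show "is_normal_form n mo \<G> 0 0"
      using poly_ring_ideal_closed(1)[OF poly_ring_genideal(1)[OF basis_subset]]
        subring_zero[OF subring_polys_UNIV]
      by (simp add: is_normal_form_def)
  qed (rule subring_zero[OF PA])
  show ?thesis
    using F
  proof (induction S rule: infinite_finite_induct)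
    case (insert i S)
    obtain r where r: "r \<in> polys n A" "is_normal_form n mo \<G> (F i) r"
      using insert.prems by blast
    obtain s where s: "s \<in> polys n A" "is_normal_form n mo \<G> (sum F S) s"
      using insert.IH insert.prems by blast
    have "is_normal_form n mo \<G> (sum F (insert i S)) (r + s)"
      using is_normal_form_add[OF basis_subset r(2) s(2)] insert.hyps by simp
    then show ?case using subring_closed(3)[OF PA r(1) s(1)] by blast
  qed (simp_all add: zero)
qed

text \<open>Multivariate division, restricted to a single term \<open>c x\<^sup>m\<close>. If \<open>m\<close> is divisible by a leading
  monomial, subtracting \<open>c x\<^sup>u g\<close> replaces the term by terms with smaller monomials. Because the basis
  is monic no division of coefficients takes place, so coefficients stay in any subring \<open>A\<close> that
  contains those of the basis; this is why the invariantization map has values in \<open>A\<close>.\<close>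
lemma normal_form_single:
  assumes A: "subring A ring_of_type_algebra" and GA: "\<G> \<subseteq> polys n A"
    and m: "m \<in> monoms n" and c: "c \<in> A"
  shows "\<exists>r\<in>polys n A. is_normal_form n mo \<G> (Poly_Mapping.single m c) r"
  using wf_strict m c
proof (induction m arbitrary: c rule: wf_induct_rule)
  case (less m)
  note PA = subring_polys[OF A, of n]
  note Idl = poly_ring_genideal[OF basis_subset]
  show ?case
  proof (cases "Poly_Mapping.single m (1::'l) \<in> leading_ideal n mo \<G>")
    case False
    then have "is_normal_form n mo \<G> (Poly_Mapping.single m c) (Poly_Mapping.single m c)"
      using less.prems poly_ring_ideal_closed(1)[OF Idl(1)] single_in_polys[of m n c UNIV]
      by (simp add: is_normal_form_def)
    then show ?thesis using single_in_polys less.prems by blast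
  next
    case True
    then obtain g u where g: "g \<in> \<G>" "g \<noteq> 0" and u: "u \<in> monoms n"
      and m_eq: "m = lead_monom mo g + u"
      using single_in_leading_ideal_iff[OF basis_subset] by blast
    have gA: "g \<in> polys n A" and gU: "g \<in> polys n UNIV" using g GA basis_subset by auto
    define p where "p = Poly_Mapping.single u c * g"
    define q where "q = Poly_Mapping.single m c - p"
    \<comment> \<open>Stated at shifted monomials only; it shows that the term at \<open>m\<close> is cancelled.\<close>
    have lookup_p: "Poly_Mapping.lookup p (k + u) = c * Poly_Mapping.lookup g k" for k
    proof -
      have "p = (\<Sum>k\<in>Poly_Mapping.keys g. Poly_Mapping.single (k + u) (c * Poly_Mapping.lookup g k))"
        unfolding p_def
        by (subst poly_eq_sum_single[of g]) (simp add: sum_distrib_left mult_single add.commute)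
      then show ?thesis
        by (simp add: lookup_sum lookup_single when_def in_keys_iff)
    qed
    have "p \<in> polys n A"
      unfolding p_def by (intro subring_closed(4)[OF PA] single_in_polys u less.prems gA)
    then have qA: "q \<in> polys n A"
      unfolding q_def by (intro subring_diff[OF PA] single_in_polys less.prems)
    have smaller: "(k, m) \<in> mo - Id" if k: "k \<in> Poly_Mapping.keys q" for k
    proof -
      have lq: "Poly_Mapping.lookup q m = 0"
        unfolding q_def lookup_minus
        using lookup_p[of "lead_monom mo g"] basis_facts(4)[OF g(1)] m_eq by simp
      then have km: "k \<noteq> m" using k by (auto simp: in_keys_iff)
      then have "k \<in> Poly_Mapping.keys p"
        using k by (auto simp: q_def in_keys_iff lookup_minus lookup_single_not_eq)
      then obtain k' where k': "k' \<in> Poly_Mapping.keys g" "k = k' + u"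
        using keys_mult[of "Poly_Mapping.single u c" g]
        by (auto simp: p_def add.commute split: if_splits)
      have "(k' + u, lead_monom mo g + u) \<in> mo"
        using order_facts(7)[OF lead_monom_props(2)[OF gU g(2) k'(1)] u] .
      then show ?thesis using km k' m_eq by simp
    qed
    have "\<exists>r\<in>polys n A. is_normal_form n mo \<G>
        (\<Sum>k\<in>Poly_Mapping.keys q. Poly_Mapping.single k (Poly_Mapping.lookup q k)) r"
    proof (rule normal_form_sum[OF A])
      fix k assume k: "k \<in> Poly_Mapping.keys q"
      show "\<exists>r\<in>polys n A. is_normal_form n mo \<G>
          (Poly_Mapping.single k (Poly_Mapping.lookup q k)) r"
        by (rule less.IH[OF smaller[OF k]]) (use k qA in \<open>auto simp: polys_def\<close>)
    qed
    then obtain r where r: "r \<in> polys n A" "is_normal_form n mo \<G> q r"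
      using poly_eq_sum_single[of q] by auto
    have "g \<in> Idl\<^bsub>poly_ring n\<^esub> \<G>" using Idl(2) g by blast
    then have "p \<in> Idl\<^bsub>poly_ring n\<^esub> \<G>"
      unfolding p_def using poly_ring_ideal_closed(3)[OF Idl(1)] single_in_polys[OF u, of c UNIV]
      by blast
    then have "(q - r) + p \<in> Idl\<^bsub>poly_ring n\<^esub> \<G>"
      using poly_ring_ideal_closed(2)[OF Idl(1)] r(2) unfolding is_normal_form_def by blast
    then have "is_normal_form n mo \<G> (Poly_Mapping.single m c) r"
      using r(2) by (simp add: is_normal_form_def q_def algebra_simps)
    then show ?thesis using r(1) by blast
  qed
qed

lemma normal_form_exists:
  assumes A: "subring A ring_of_type_algebra" and GA: "\<G> \<subseteq> polys n A" and f: "f \<in> polys n A"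
  shows "\<exists>r\<in>polys n A. is_normal_form n mo \<G> f r"
proof -
  have "\<exists>r\<in>polys n A. is_normal_form n mo \<G>
      (\<Sum>k\<in>Poly_Mapping.keys f. Poly_Mapping.single k (Poly_Mapping.lookup f k)) r"
    by (intro normal_form_sum[OF A] normal_form_single[OF A GA]) (use f in \<open>auto simp: polys_def\<close>)
  then show ?thesis using poly_eq_sum_single[of f] by auto
qed

text \<open>The normal form of an element of \<open>E\<close> lies in \<open>E\<close> and is irreducible, hence is zero.\<close>
lemma Idl_basis_eq: "Idl\<^bsub>poly_ring n\<^esub> \<G> = E"
proof
  show "E \<subseteq> Idl\<^bsub>poly_ring n\<^esub> \<G>"
  proof
    fix f assume f: "f \<in> E"
    have "subring (UNIV :: 'l set) ring_of_type_algebra" by (simp add: subring_type_iff)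
    then obtain r where r: "is_normal_form n mo \<G> f r"
      using normal_form_exists[OF _ basis_subset] E_subset f by blast
    then have fr: "f - r \<in> Idl\<^bsub>poly_ring n\<^esub> \<G>" by (simp add: is_normal_form_def)
    then have "f - (f - r) \<in> E"
      using poly_ring_ideal_diff[OF ideal_E f] Idl_subset by blast
    then have "r = 0" using r by (intro zero_if_irreducible) (auto simp: is_normal_form_def)
    then show "f \<in> Idl\<^bsub>poly_ring n\<^esub> \<G>" using fr by simp
  qed
qed (rule Idl_subset)

lemma NF_eqI:
  assumes "is_normal_form n mo \<G> f r"
  shows "NF n mo \<G> f = r"
  unfolding NF_def is_normal_form_def[symmetric]
proof (rule the_equality, rule assms)
  fix s assume s: "is_normal_form n mo \<G> f s"
  have "(f - r) - (f - s) \<in> E"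
    by (rule poly_ring_ideal_diff[OF ideal_E])
      (use assms s in \<open>auto simp: is_normal_form_def Idl_basis_eq\<close>)
  then have "s - r \<in> E" by simp
  moreover have "Poly_Mapping.keys (s - r) \<subseteq> Poly_Mapping.keys s \<union> Poly_Mapping.keys r"
    by (auto simp: in_keys_iff lookup_minus)
  ultimately have "s - r = 0"
    using assms s by (intro zero_if_irreducible) (auto simp: is_normal_form_def)
  then show "s = r" by simp
qed

lemma NF_is_normal_form:
  assumes "f \<in> polys n UNIV"
  shows "is_normal_form n mo \<G> f (NF n mo \<G> f)"
proof -
  have "subring (UNIV :: 'l set) ring_of_type_algebra" by (simp add: subring_type_iff)
  then obtain r where "is_normal_form n mo \<G> f r"
    using normal_form_exists[OF _ basis_subset assms] by blast
  then show ?thesis using NF_eqI by simp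
qed

lemma NF_in_polys:
  assumes "subring A ring_of_type_algebra" "\<G> \<subseteq> polys n A" "f \<in> polys n A"
  shows "NF n mo \<G> f \<in> polys n A"
  using normal_form_exists[OF assms] NF_eqI by blast

lemma NF_add:
  assumes "f \<in> polys n UNIV" "g \<in> polys n UNIV"
  shows "NF n mo \<G> (f + g) = NF n mo \<G> f + NF n mo \<G> g"
  using assms by (intro NF_eqI is_normal_form_add NF_is_normal_form basis_subset)

lemma NF_const_mult:
  assumes "f \<in> polys n UNIV"
  shows "NF n mo \<G> (const_poly c * f) = const_poly c * NF n mo \<G> f"
  using assms by (intro NF_eqI is_normal_form_const_mult NF_is_normal_form basis_subset)

text \<open>The normal form depends only on the class modulo \<open>E\<close>. Both the well-definedness of the
  invariantization map and its linearity over the invariants reduce to exhibiting elements of \<open>E\<close>.\<close>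
lemma NF_cong:
  assumes g: "g \<in> polys n UNIV" and fg: "f - g \<in> E"
  shows "NF n mo \<G> f = NF n mo \<G> g"
proof (rule NF_eqI)
  let ?r = "NF n mo \<G> g"
  have r: "is_normal_form n mo \<G> g ?r" using g by (rule NF_is_normal_form)
  then have "(f - g) + (g - ?r) \<in> E"
    using fg poly_ring_ideal_closed(2)[OF ideal_E] unfolding is_normal_form_def Idl_basis_eq
    by blast
  then show "is_normal_form n mo \<G> f ?r"
    using r by (simp add: is_normal_form_def Idl_basis_eq)
qed

text \<open>If \<open>1\<close> were reducible, some leading monomial would be \<open>1\<close>, and the basis would contain the constant
  \<open>1\<close>, so that \<open>E\<close> would be the whole ring. This is where properness enters.\<close>
lemma NF_one:
  assumes "E \<noteq> carrier (poly_ring n)"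
  shows "NF n mo \<G> 1 = 1"
proof (rule NF_eqI)
  have one: "1 \<in> polys n (UNIV :: 'l set)" by (rule subring_closed(1)[OF subring_polys_UNIV])
  have "Poly_Mapping.single 0 1 \<notin> leading_ideal n mo \<G>"
  proof
    assume "Poly_Mapping.single 0 1 \<in> leading_ideal n mo \<G>"
    then obtain g u where g: "g \<in> \<G>" "g \<noteq> 0" and "0 = lead_monom mo g + u"
      using single_in_leading_ideal_iff[OF basis_subset] by blast
    then have lm: "lead_monom mo g = 0"
      by (auto simp: poly_mapping_eq_iff lookup_add fun_eq_iff)
    have gU: "g \<in> polys n UNIV" using g basis_subset by blast
    have "k = 0" if "k \<in> Poly_Mapping.keys g" for k
      using lead_monom_props(2)[OF gU g(2) that] order_facts(6)[of k] order_facts(2) gU that lm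
      by (auto simp: polys_def dest: antisymD)
    moreover have "Poly_Mapping.lookup g 0 = 1" using basis_facts(4)[OF g(1)] lm by simp
    ultimately have "g = 1"
      by (intro poly_mapping_eqI) (auto simp: lookup_one when_def in_keys_iff)
    then have "1 \<in> E" using g basis_facts(1) by blast
    then have "f \<in> E" if "f \<in> polys n UNIV" for f
      using poly_ring_ideal_closed(3)[OF ideal_E, of 1 f] that by simp
    then show False using assms E_subset by auto
  qed
  then show "is_normal_form n mo \<G> 1 1"
    using one poly_ring_ideal_closed(1)[OF poly_ring_genideal(1)[OF basis_subset]]
    by (simp add: is_normal_form_def)
qed

end


section \<open>Ideals of points and the Derksen ideal\<close>

text \<open>Modulo the ideal of a point, each variable is its coordinate, so each polynomial is its value.\<close>
lemma sub_value_in_point_ideal: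
  fixes f :: "'l::comm_ring_1 mpoly"
  assumes I: "ideal I (poly_ring n)"
    and gens: "\<And>i. i < n \<Longrightarrow> var_poly i - const_poly (p i) \<in> I"
    and f: "f \<in> polys n UNIV"
  shows "f - const_poly (eval_poly p f) \<in> I"
proof -
  note Icl = poly_ring_ideal_closed[OF I]
  have "subring (UNIV :: 'l set) ring_of_type_algebra" by (simp add: subring_type_iff)
  then show ?thesis
    using f
  proof (induction rule: polys_induct)
    case (const c)
    then show ?case by (simp add: Icl)
  next
    case (var i)
    then show ?case by (simp add: gens)
  next
    case (add f g)
    have "f + g - const_poly (eval_poly p (f + g)) =
        (f - const_poly (eval_poly p f)) + (g - const_poly (eval_poly p g))"
      by (simp add: eval_poly_add const_poly_def single_add)
    then show ?case using Icl(2)[OF add.IH] by (simp only:)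
  next
    case (mult f g)
    have "f * g - const_poly (eval_poly p (f * g)) =
        f * (g - const_poly (eval_poly p g)) + const_poly (eval_poly p g) * (f - const_poly (eval_poly p f))"
    proof -
      have "const_poly (eval_poly p (f * g)) = const_poly (eval_poly p g) * const_poly (eval_poly p f)"
        by (simp add: eval_poly_mult const_poly_def mult_single mult.commute)
      then show ?thesis by (simp add: algebra_simps)
    qed
    then show ?case
      using Icl(2)[OF Icl(3)[OF mult.IH(2) mult.hyps(1)] Icl(3)[OF mult.IH(1) const_in_polys[OF UNIV_I]]]
      by (simp only:)
  qed
qed

text \<open>The ideal of a point consists of the polynomials that vanish there, so the Derksen ideal is the
  vanishing ideal of the orbit of \<open>a\<close>.\<close>
lemma in_Derksen_ideal_if_vanishing:
  fixes f :: "'l::field mpoly"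
  assumes f: "f \<in> polys n UNIV"
    and van: "\<And>g. g \<in> carrier G \<Longrightarrow> eval_poly (\<lambda>i. act g (a i)) f = 0"
  shows "f \<in> Derksen_ideal G act n a"
  unfolding Derksen_ideal_def
proof
  fix g assume g: "g \<in> carrier G"
  let ?S = "(\<lambda>i. var_poly i - const_poly (act g (a i))) ` {..<n}"
  have S: "?S \<subseteq> polys n UNIV"
    by (auto intro!: subring_diff[OF subring_polys_UNIV] var_in_polys const_in_polys)
  have "f - const_poly (eval_poly (\<lambda>i. act g (a i)) f) \<in> Idl\<^bsub>poly_ring n\<^esub> ?S"
    by (rule sub_value_in_point_ideal[OF poly_ring_genideal(1)[OF S] _ f])
      (use poly_ring_genideal(2)[OF S] in blast)
  then show "f \<in> Idl\<^bsub>poly_ring n\<^esub> ?S"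
    using van[OF g] by (simp add: const_poly_def)
qed

section \<open>The group action and values of polynomials\<close>

lemma act_hom:
  assumes "acts_by_automorphisms G act" "g \<in> carrier G"
  shows "act g (x + y) = act g x + act g y" "act g (x * y) = act g x * act g y" "act g 1 = 1"
proof -
  have "act g \<in> ring_hom ring_of_type_algebra ring_of_type_algebra"
    using assms by (auto simp: acts_by_automorphisms_def ring_iso_def)
  from ring_hom_memE[OF this]
  show "act g (x + y) = act g x + act g y" "act g (x * y) = act g x * act g y" "act g 1 = 1"
    by simp_all
qed

lemma act_minus:
  assumes "acts_by_automorphisms G act" "g \<in> carrier G"
  shows "act g (- x) = - act g x"
proof -
  have "act g 0 + act g 0 = act g 0 + 0" using act_hom(1)[OF assms, of 0 0] by simp
  then have "act g 0 = 0" by (simp only: add_left_cancel)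
  then show ?thesis using act_hom(1)[OF assms, of x "- x"] by (simp add: eq_neg_iff_add_eq_0 add.commute)
qed

lemma subring_fixed:
  assumes "acts_by_automorphisms G act" "subring B ring_of_type_algebra"
  shows "subring (fixed G act B) ring_of_type_algebra"
  using act_hom[OF assms(1)] act_minus[OF assms(1)] subring_closed[OF assms(2)]
  by (auto simp: subring_type_iff fixed_def)

text \<open>As the coefficients are fixed by the group, the value at a translated point is the translated value.
  A relation \<open>f(a) = 0\<close> over \<open>K\<close> therefore holds on the whole orbit.\<close>
lemma eval_poly_act:
  assumes act: "acts_by_automorphisms G act" and g: "g \<in> carrier G"
    and K: "subring K ring_of_type_algebra" "K \<subseteq> fixed G act UNIV" and f: "f \<in> polys n K"
  shows "eval_poly (\<lambda>i. act g (a i)) f = act g (eval_poly a f)"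
  using K(1) f
proof (induction rule: polys_induct)
  case (const c)
  then show ?case using K(2) g by (auto simp: fixed_def)
qed (simp_all add: eval_poly_add eval_poly_mult act_hom[OF act g])


section \<open>The invariantization map\<close>

locale invariantization_setting =
  reduced_Groebner n mo E \<G>
  for n mo and E \<G> :: "'l::field mpoly set" +
  fixes G :: "('g, 'm) monoid_scheme" and act :: "'g \<Rightarrow> 'l \<Rightarrow> 'l"
    and K :: "'l set" and a :: "nat \<Rightarrow> 'l"
  assumes act: "acts_by_automorphisms G act"
    and K: "subring K ring_of_type_algebra" "K \<subseteq> fixed G act UNIV"
    and proper: "E \<noteq> carrier (poly_ring n)"
    and Derksen_subset: "Derksen_ideal G act n a \<subseteq> E"
begin

abbreviation R :: "'l set" where "R \<equiv> subalgebra_gen K (a ` {..<n})"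
abbreviation A :: "'l set" where "A \<equiv> subalgebra_gen K (coeffs_of \<G>)"
abbreviation RG :: "'l set" where "RG \<equiv> fixed G act R"
abbreviation \<phi> :: "'l \<Rightarrow> 'l" where "\<phi> \<equiv> invariantization n mo K a \<G>"

text \<open>The central observation: a polynomial over \<open>K\<close> whose value at \<open>a\<close> is an invariant takes this same
  value at every point of the orbit, so modulo \<open>E\<close> it may be replaced by the value.\<close>
lemma in_E_if_value_invariant:
  assumes f: "f \<in> polys n K" and inv: "eval_poly a f \<in> fixed G act UNIV"
  shows "f - const_poly (eval_poly a f) \<in> E"
proof -
  let ?h = "f - const_poly (eval_poly a f)"
  have "?h \<in> polys n UNIV"
    using f polys_mono[of K UNIV n]
    by (intro subring_diff[OF subring_polys_UNIV] const_in_polys) auto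
  moreover have "eval_poly (\<lambda>i. act g (a i)) ?h = 0" if "g \<in> carrier G" for g
    using inv that by (simp add: eval_poly_diff eval_poly_act[OF act that K f] fixed_def)
  ultimately show ?thesis
    using in_Derksen_ideal_if_vanishing Derksen_subset by blast
qed

text \<open>This is what makes the invariantization map well defined: the difference of two representatives has
  the invariant value \<open>0\<close>.\<close>
lemma NF_eq_if_value_eq:
  assumes f: "f \<in> polys n K" and g: "g \<in> polys n K" and eq: "eval_poly a f = eval_poly a g"
  shows "NF n mo \<G> f = NF n mo \<G> g"
proof -
  have d: "f - g \<in> polys n K" by (rule subring_diff[OF subring_polys[OF K(1)] f g])
  have "eval_poly a (f - g) = 0" using eq by (simp add: eval_poly_diff)
  moreover have "0 \<in> fixed G act UNIV"
    using subring_zero[OF K(1)] K(2) by blast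
  ultimately have "f - g \<in> E"
    using in_E_if_value_invariant[OF d] by (simp add: const_poly_def)
  then show ?thesis
    using g polys_mono[of K UNIV n] by (intro NF_cong) auto
qed

lemma invariantization_rel_eval:
  assumes f: "f \<in> polys n K"
  shows "invariantization_rel n mo K a \<G> (eval_poly a f) v \<longleftrightarrow> v = eval_poly (\<lambda>_. 0) (NF n mo \<G> f)"
  using f NF_eq_if_value_eq[OF f] unfolding invariantization_rel_def by metis

lemma invariantization_well_defined:
  assumes "b \<in> R"
  shows "\<exists>!v. invariantization_rel n mo K a \<G> b v"
  using assms by (auto simp: subalgebra_gen_eq_eval[OF K(1)] invariantization_rel_eval)

lemma invariantization_eval:
  assumes "f \<in> polys n K"
  shows "\<phi> (eval_poly a f) = eval_poly (\<lambda>_. 0) (NF n mo \<G> f)"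
  unfolding invariantization_def by (rule the_equality) (simp_all add: invariantization_rel_eval[OF assms])

lemma subrings: "subring R ring_of_type_algebra" "subring A ring_of_type_algebra"
    "subring RG ring_of_type_algebra" "RG \<subseteq> R"
  using subring_subalgebra_gen subring_fixed[OF act subring_subalgebra_gen]
  by (auto simp: fixed_def)

lemma invariantization_in_A:
  assumes "b \<in> R"
  shows "\<phi> b \<in> A"
proof -
  obtain f where f: "f \<in> polys n K" "b = eval_poly a f"
    using assms by (auto simp: subalgebra_gen_eq_eval[OF K(1)])
  have "\<G> \<subseteq> polys n A"
    using basis_subset subalgebra_gen_incl(2)[of "coeffs_of \<G>" K]
    by (fastforce simp: polys_def coeffs_of_def)
  then have "NF n mo \<G> f \<in> polys n A"
    using NF_in_polys[OF subrings(2)] f(1) polys_mono[OF subalgebra_gen_incl(1)[of K "coeffs_of \<G>"], of n]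
    by blast
  then show ?thesis
    using invariantization_eval[OF f(1)] f(2) eval_poly_at_zero_in_subring[OF subrings(2)] by simp
qed

lemma invariantization_add:
  assumes "b \<in> R" "c \<in> R"
  shows "\<phi> (b + c) = \<phi> b + \<phi> c"
proof -
  obtain f g where f: "f \<in> polys n K" "b = eval_poly a f" and g: "g \<in> polys n K" "c = eval_poly a g"
    using assms by (auto simp: subalgebra_gen_eq_eval[OF K(1)])
  have U: "f \<in> polys n UNIV" "g \<in> polys n UNIV"
    using f g polys_mono[of K UNIV n] by auto
  have fg: "f + g \<in> polys n K" using subring_closed(3)[OF subring_polys[OF K(1)] f(1) g(1)] .
  show ?thesis
    using invariantization_eval[OF fg] invariantization_eval[OF f(1)] invariantization_eval[OF g(1)]
      f g NF_add[OF U] by (simp add: eval_poly_add)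
qed

text \<open>For \<open>s = h(a)\<close> invariant, \<open>h\<close> and the constant \<open>s\<close> agree modulo \<open>E\<close>; and normal forms are linear over
  \<open>L\<close>, so multiplication by the constant \<open>s\<close> commutes with taking normal forms although \<open>s\<close> need not
  lie in \<open>K\<close>.\<close>
lemma invariantization_linear:
  assumes "s \<in> RG" "b \<in> R"
  shows "\<phi> (s * b) = s * \<phi> b"
proof -
  obtain h f where h: "h \<in> polys n K" "s = eval_poly a h" and f: "f \<in> polys n K" "b = eval_poly a f"
    using assms subrings(4) by (auto simp: subalgebra_gen_eq_eval[OF K(1)])
  have U: "f \<in> polys n UNIV" using f polys_mono[of K UNIV n] by auto
  have hf: "h * f \<in> polys n K" using subring_closed(4)[OF subring_polys[OF K(1)] h(1) f(1)] .
  have "h - const_poly s \<in> E"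
    using in_E_if_value_invariant[OF h(1)] assms(1) h(2) by (auto simp: fixed_def)
  then have "f * (h - const_poly s) \<in> E" using poly_ring_ideal_closed(3)[OF ideal_E] U by blast
  then have "h * f - const_poly s * f \<in> E" by (simp add: algebra_simps)
  then have "NF n mo \<G> (h * f) = NF n mo \<G> (const_poly s * f)"
    by (intro NF_cong subring_closed(4)[OF subring_polys_UNIV] const_in_polys U UNIV_I)
  also have "\<dots> = const_poly s * NF n mo \<G> f" by (rule NF_const_mult[OF U])
  finally have "eval_poly (\<lambda>_. 0) (NF n mo \<G> (h * f)) = s * eval_poly (\<lambda>_. 0) (NF n mo \<G> f)"
    by (simp add: eval_poly_mult)
  then show ?thesis
    using invariantization_eval[OF hf] invariantization_eval[OF f(1)] h(2) f(2)
    by (simp add: eval_poly_mult)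
qed

lemma invariantization_invariant:
  assumes "s \<in> RG"
  shows "\<phi> s = s"
proof -
  have one: "1 \<in> polys n K" by (rule subring_closed(1)[OF subring_polys[OF K(1)]])
  have eval_one: "eval_poly p 1 = 1" for p :: "nat \<Rightarrow> 'l"
    using eval_poly_const[of p 1] by (simp add: const_poly_def)
  have "\<phi> 1 = 1"
    using invariantization_eval[OF one] NF_one[OF proper] by (simp add: eval_one)
  then show ?thesis
    using invariantization_linear[OF assms subring_closed(1)[OF subrings(1)]] by simp
qed

text \<open>Needed for \<open>A\<close> to be a module over the ring of invariants at all.\<close>
lemma RG_subset_A: "RG \<subseteq> A"
  using invariantization_in_A invariantization_invariant subrings(4) by (metis subset_iff)

end


section \<open>Modules inside the field\<close>

lemma sub_mod_simps [simp]:
  "carrier (sub_mod M) = M" "x \<oplus>\<^bsub>sub_mod M\<^esub> y = x + y" "\<zero>\<^bsub>sub_mod M\<^esub> = 0"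
  "r \<odot>\<^bsub>sub_mod M\<^esub> x = r * x"
  by (simp_all add: sub_mod_def)

lemma module_sub_mod:
  assumes S: "subring S ring_of_type_algebra" and M: "subring M ring_of_type_algebra" "S \<subseteq> M"
  shows "module (sub_ring S) (sub_mod M)"
proof (rule moduleI[OF cring_sub_ring[OF S]])
  show "abelian_group (sub_mod M)"
  proof (rule abelian_groupI)
    fix x assume "x \<in> carrier (sub_mod M)"
    then show "\<exists>y\<in>carrier (sub_mod M). y \<oplus>\<^bsub>sub_mod M\<^esub> x = \<zero>\<^bsub>sub_mod M\<^esub>"
      using subring_closed(2)[OF M(1)] by (auto intro!: bexI[of _ "- x"])
  qed (auto simp: subring_closed[OF M(1)] subring_zero[OF M(1)])
qed (use M(2) in \<open>auto simp: subring_closed[OF M(1)] algebra_simps\<close>)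

lemma is_module_hom_sub_iff:
  assumes "subring S ring_of_type_algebra" "subring M ring_of_type_algebra" "S \<subseteq> M"
    "subring N ring_of_type_algebra" "S \<subseteq> N"
  shows "is_module_hom (sub_ring S) (sub_mod M) (sub_mod N) h \<longleftrightarrow>
    (\<forall>x\<in>M. h x \<in> N) \<and> (\<forall>x\<in>M. \<forall>y\<in>M. h (x + y) = h x + h y) \<and> (\<forall>s\<in>S. \<forall>x\<in>M. h (s * x) = s * h x)"
  using module_sub_mod[OF assms(1,2,3)] module_sub_mod[OF assms(1,4,5)]
  by (auto simp: is_module_hom_def hom_def)


section \<open>Localization\<close>

lemma subring_localize: "subring (localize B c) ring_of_type_algebra"
  unfolding localize_def by (rule subring_subalgebra_gen)

lemma localize_incl: "B \<subseteq> localize B c" "inverse c \<in> localize B c"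
  unfolding localize_def using subalgebra_gen_incl[where K = B and S = "{inverse c}"] by auto

lemma localize_mono: "B \<subseteq> C \<Longrightarrow> localize B c \<subseteq> localize C c"
  unfolding localize_def
  using subalgebra_gen_incl subalgebra_gen_minimal[OF subring_subalgebra_gen] by (metis order_trans)

text \<open>The elements with a denominator that is a power of \<open>c\<close> form a subring containing \<open>B\<close> and \<open>1/c\<close>.\<close>
lemma localize_clear_denominator:
  assumes B: "subring B ring_of_type_algebra" and c: "c \<in> B" "c \<noteq> 0" and x: "x \<in> localize B c"
  shows "\<exists>k. c ^ k * x \<in> B"
proof -
  let ?S = "{x. \<exists>k. c ^ k * x \<in> B}"
  note Bcl = subring_closed[OF B] subring_power[OF B c(1)]
  have "subring ?S ring_of_type_algebra"
    unfolding subring_type_iff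
  proof (intro conjI ballI)
    show "1 \<in> ?S" using Bcl(1) by (auto intro!: exI[of _ 0])
  next
    fix x assume "x \<in> ?S"
    then show "- x \<in> ?S" using Bcl(2) by fastforce
  next
    fix x y assume "x \<in> ?S" "y \<in> ?S"
    then obtain k l where kl: "c ^ k * x \<in> B" "c ^ l * y \<in> B" by blast
    have "c ^ (k + l) * (x + y) = c ^ l * (c ^ k * x) + c ^ k * (c ^ l * y)"
      by (simp add: power_add algebra_simps)
    then have "c ^ (k + l) * (x + y) \<in> B" using kl Bcl by metis
    then show "x + y \<in> ?S" by blast
    have "c ^ (k + l) * (x * y) = (c ^ k * x) * (c ^ l * y)"
      by (simp add: power_add algebra_simps)
    then have "c ^ (k + l) * (x * y) \<in> B" using kl Bcl by metis
    then show "x * y \<in> ?S" by blast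
  qed
  moreover have "B \<subseteq> ?S" by (auto intro!: exI[of _ 0])
  moreover have "{inverse c} \<subseteq> ?S" using c Bcl(1) by (auto intro!: exI[of _ 1])
  ultimately show ?thesis
    using x subalgebra_gen_minimal unfolding localize_def by blast
qed

text \<open>
  The passage to the localization is a fact about linear maps: any \<open>S\<close>-linear map on \<open>R\<close> that is the
  identity on \<open>S\<close> and has values in \<open>S\<^sub>c\<close> extends to a projection. Values in \<open>S\<^sub>c\<close> instead of
  \<open>S\<close> are allowed because the invariantization map has values in \<open>A\<close>, and \<open>A\<close> is only known to lie in
  the localized ring of invariants.\<close>
locale retraction_to_localize =
  fixes S R :: "'l::field set" and c :: 'l and \<phi> :: "'l \<Rightarrow> 'l"
  assumes S: "subring S ring_of_type_algebra" and R: "subring R ring_of_type_algebra" and SR: "S \<subseteq> R"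
    and c: "c \<in> S" "c \<noteq> 0"
    and \<phi>_range: "x \<in> R \<Longrightarrow> \<phi> x \<in> localize S c"
    and \<phi>_add: "x \<in> R \<Longrightarrow> y \<in> R \<Longrightarrow> \<phi> (x + y) = \<phi> x + \<phi> y"
    and \<phi>_linear: "s \<in> S \<Longrightarrow> x \<in> R \<Longrightarrow> \<phi> (s * x) = s * \<phi> x"
    and \<phi>_id: "s \<in> S \<Longrightarrow> \<phi> s = s"
begin

lemma cR: "c \<in> R" using c SR by blast

text \<open>
  The exponent is chosen arbitrarily; the value does not depend on it.\<close>
definition \<psi> :: "'l \<Rightarrow> 'l" where
  "\<psi> = (\<lambda>x\<in>localize R c. let k = (SOME k. c ^ k * x \<in> R) in \<phi> (c ^ k * x) / c ^ k)"

text \<open>With two exponents \<open>k\<close> and \<open>l\<close>, both values are compared with that of the product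
  \<open>c\<^sup>k c\<^sup>l x\<close>; linearity applies since \<open>c\<close> lies in \<open>S\<close>.\<close>
lemma \<psi>_eq:
  assumes k: "c ^ k * x \<in> R" and x: "x \<in> localize R c"
  shows "\<psi> x = \<phi> (c ^ k * x) / c ^ k"
proof -
  define l where "l = (SOME l. c ^ l * x \<in> R)"
  have l: "c ^ l * x \<in> R" unfolding l_def by (rule someI[of _ k]) (rule k)
  have "c ^ l * \<phi> (c ^ k * x) = \<phi> (c ^ l * (c ^ k * x))"
    using \<phi>_linear[OF subring_power[OF S c(1)] k] by simp
  also have "\<dots> = \<phi> (c ^ k * (c ^ l * x))" by (simp add: mult_ac)
  also have "\<dots> = c ^ k * \<phi> (c ^ l * x)"
    using \<phi>_linear[OF subring_power[OF S c(1)] l] by simp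
  finally have "\<phi> (c ^ l * x) / c ^ l = \<phi> (c ^ k * x) / c ^ k"
    using c(2) by (simp add: field_simps)
  then show ?thesis
    using x by (simp add: \<psi>_def Let_def flip: l_def)
qed

lemma localize_facts:
  "subring (localize S c) ring_of_type_algebra" "subring (localize R c) ring_of_type_algebra"
  "localize S c \<subseteq> localize R c"
  by (simp_all add: subring_localize localize_mono SR)

lemma inverse_power_in_localize: "inverse c ^ k \<in> localize S c"
  by (rule subring_power[OF subring_localize localize_incl(2)])

lemma \<psi>_range:
  assumes "x \<in> localize R c" shows "\<psi> x \<in> localize S c"
proof -
  obtain k where k: "c ^ k * x \<in> R" using localize_clear_denominator[OF R cR c(2) assms] by blast
  have "\<psi> x = inverse c ^ k * \<phi> (c ^ k * x)"
    by (simp add: \<psi>_eq[OF k assms] field_simps)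
  then show ?thesis
    using \<phi>_range[OF k] inverse_power_in_localize subring_closed(4)[OF subring_localize] by metis
qed

lemma \<psi>_extends: "x \<in> R \<Longrightarrow> \<psi> x = \<phi> x"
  using \<psi>_eq[of 0 x] localize_incl(1) by auto

lemma \<psi>_add:
  assumes x: "x \<in> localize R c" and y: "y \<in> localize R c"
  shows "\<psi> (x + y) = \<psi> x + \<psi> y"
proof -
  note pR = subring_power[OF R cR]
  obtain k where k: "c ^ k * x \<in> R" using localize_clear_denominator[OF R cR c(2) x] by blast
  obtain l where l: "c ^ l * y \<in> R" using localize_clear_denominator[OF R cR c(2) y] by blast
  have "c ^ l * (c ^ k * x) \<in> R" "c ^ k * (c ^ l * y) \<in> R"
    using subring_closed(4)[OF R pR] k l by auto
  then have xR: "c ^ (k + l) * x \<in> R" and yR: "c ^ (k + l) * y \<in> R"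
    by (simp_all add: power_add mult_ac)
  have "c ^ (k + l) * (x + y) \<in> R" "x + y \<in> localize R c"
    using subring_closed(3)[OF R xR yR] subring_closed(3)[OF subring_localize x y]
    by (simp_all add: distrib_left)
  then show ?thesis
    using \<psi>_eq[of "k + l"] xR yR x y \<phi>_add[OF xR yR] by (simp add: distrib_left add_divide_distrib)
qed

lemma \<psi>_linear:
  assumes s: "s \<in> localize S c" and x: "x \<in> localize R c"
  shows "\<psi> (s * x) = s * \<psi> x"
proof -
  obtain k where k: "c ^ k * s \<in> S" using localize_clear_denominator[OF S c s] by blast
  obtain l where l: "c ^ l * x \<in> R" using localize_clear_denominator[OF R cR c(2) x] by blast
  have eq: "c ^ (k + l) * (s * x) = (c ^ k * s) * (c ^ l * x)"
    by (simp add: power_add mult_ac)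
  then have "c ^ (k + l) * (s * x) \<in> R"
    using k l SR subring_closed(4)[OF R] by (metis subsetD)
  moreover have "s * x \<in> localize R c"
    using s x localize_facts subring_closed(4)[OF localize_facts(2)] by blast
  ultimately have "\<psi> (s * x) = \<phi> ((c ^ k * s) * (c ^ l * x)) / c ^ (k + l)"
    using \<psi>_eq[of "k + l" "s * x"] unfolding eq by blast
  also have "\<dots> = (c ^ k * s) * \<phi> (c ^ l * x) / c ^ (k + l)"
    using \<phi>_linear[OF k l] by simp
  also have "\<dots> = s * \<psi> x"
    using \<psi>_eq[OF l x] c(2) by (simp add: power_add)
  finally show ?thesis .
qed

lemma \<psi>_id:
  assumes "s \<in> localize S c" shows "\<psi> s = s"
proof -
  have "1 \<in> S" by (rule subring_closed(1)[OF S])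
  then have "\<psi> 1 = 1" using \<psi>_extends \<phi>_id SR by auto
  then show ?thesis
    using \<psi>_linear[OF assms subring_closed(1)[OF subring_localize]] by simp
qed

text \<open>Linearity forces \<open>c\<^sup>k \<chi>(x) = \<phi>(c\<^sup>k x)\<close>, and extensionality settles the values outside \<open>R\<^sub>c\<close>.\<close>
lemma extension_unique:
  assumes ext: "\<chi> \<in> extensional (localize R c)"
    and hom: "is_module_hom (sub_ring (localize S c)) (sub_mod (localize R c)) (sub_mod (localize S c)) \<chi>"
    and \<phi>: "\<And>b. b \<in> R \<Longrightarrow> \<chi> b = \<phi> b"
  shows "\<chi> = \<psi>"
proof (rule extensionalityI[OF ext])
  show "\<psi> \<in> extensional (localize R c)" by (simp add: \<psi>_def)
  fix x assume x: "x \<in> localize R c"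
  obtain k where k: "c ^ k * x \<in> R" using localize_clear_denominator[OF R cR c(2) x] by blast
  have "c ^ k \<in> localize S c" using subring_power[OF S c(1)] localize_incl(1) by blast
  then have "c ^ k * \<chi> x = \<phi> (c ^ k * x)"
    using hom x \<phi>[OF k]
    by (simp add: is_module_hom_sub_iff localize_facts)
  then show "\<chi> x = \<psi> x"
    using c(2) by (simp add: \<psi>_eq[OF k x] eq_divide_eq mult.commute)
qed

lemma extension_exists_unique:
  "\<exists>!\<psi>. \<psi> \<in> extensional (localize R c) \<and>
     is_module_hom (sub_ring (localize S c)) (sub_mod (localize R c)) (sub_mod (localize S c)) \<psi> \<and>
     \<psi> ` localize R c = localize S c \<and> (\<forall>x\<in>localize S c. \<psi> x = x) \<and> (\<forall>b\<in>R. \<psi> b = \<phi> b)"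
proof (rule ex1I[of _ \<psi>])
  have "is_module_hom (sub_ring (localize S c)) (sub_mod (localize R c)) (sub_mod (localize S c)) \<psi>"
    using \<psi>_range \<psi>_add \<psi>_linear by (simp add: is_module_hom_sub_iff localize_facts)
  moreover have "\<psi> ` localize R c = localize S c"
    using \<psi>_range \<psi>_id localize_facts(3) by force
  moreover have "\<psi> \<in> extensional (localize R c)" by (simp add: \<psi>_def)
  ultimately show "\<psi> \<in> extensional (localize R c) \<and>
     is_module_hom (sub_ring (localize S c)) (sub_mod (localize R c)) (sub_mod (localize S c)) \<psi> \<and>
     \<psi> ` localize R c = localize S c \<and> (\<forall>x\<in>localize S c. \<psi> x = x) \<and> (\<forall>b\<in>R. \<psi> b = \<phi> b)"
    using \<psi>_id \<psi>_extends by blast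
qed (use extension_unique in blast)

text \<open>The kernel of the projection is a complement: \<open>x = \<psi>(x) + (x - \<psi>(x))\<close>.\<close>
lemma direct_summand:
  "is_direct_summand (localize S c) (sub_ring (localize S c)) (sub_mod (localize R c))"
proof -
  note T = subring_closed[OF localize_facts(1)] subring_zero[OF localize_facts(1)]
  note M = subring_closed[OF localize_facts(2)] subring_zero[OF localize_facts(2)]
  interpret module "sub_ring (localize S c)" "sub_mod (localize R c)"
    by (rule module_sub_mod[OF localize_facts])
  have inv: "\<ominus>\<^bsub>sub_mod (localize R c)\<^esub> x = - x" if "x \<in> localize R c" for x
    by (rule M.minus_equality) (use that M in auto)
  let ?N = "{x \<in> localize R c. \<psi> x = 0}"
  have \<psi>0: "\<psi> 0 = 0" using \<psi>_id T by blast
  have \<psi>_uminus: "\<psi> (- x) = - \<psi> x" if "x \<in> localize R c" for x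
    using \<psi>_linear[OF T(2)[OF T(1)] that] by simp
  have "submodule (localize S c) (sub_ring (localize S c)) (sub_mod (localize R c))"
    by (rule submoduleI) (use localize_facts(3) T inv in auto)
  moreover have "submodule ?N (sub_ring (localize S c)) (sub_mod (localize R c))"
    by (rule submoduleI)
      (use localize_facts(3) M inv \<psi>0 \<psi>_uminus \<psi>_add \<psi>_linear in auto)
  moreover have "localize S c \<inter> ?N = {\<zero>\<^bsub>sub_mod (localize R c)\<^esub>}"
    using \<psi>_id T M \<psi>0 by auto
  moreover have "localize S c <+>\<^bsub>sub_mod (localize R c)\<^esub> ?N = carrier (sub_mod (localize R c))"
  proof (intro equalityI subsetI)
    fix x assume x: "x \<in> carrier (sub_mod (localize R c))"
    then have \<psi>x: "\<psi> x \<in> localize S c" "\<psi> x \<in> localize R c"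
      using \<psi>_range localize_facts(3) by auto
    have "x - \<psi> x \<in> localize R c" using subring_diff[OF localize_facts(2)] x \<psi>x by simp
    moreover have "\<psi> (x - \<psi> x) = 0"
      using \<psi>_add[of x "- \<psi> x"] \<psi>_uminus[OF \<psi>x(2)] \<psi>_id[OF \<psi>x(1)] M(2)[OF \<psi>x(2)] x by simp
    ultimately have "x - \<psi> x \<in> ?N" by simp
    moreover have "x = \<psi> x + (x - \<psi> x)" by simp
    ultimately show "x \<in> localize S c <+>\<^bsub>sub_mod (localize R c)\<^esub> ?N"
      unfolding set_add_def' sub_mod_simps using \<psi>x(1) by blast
  next
    fix x assume "x \<in> localize S c <+>\<^bsub>sub_mod (localize R c)\<^esub> ?N"
    then show "x \<in> carrier (sub_mod (localize R c))"
      using localize_facts(3) M by (auto simp: set_add_def')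
  qed
  ultimately show ?thesis
    unfolding is_direct_summand_def using module_axioms by blast
qed

end


section \<open>Projection of the localized algebra onto its invariants\<close>

theorem theorem1p6:
  fixes G :: "('g, 'm) monoid_scheme"
    and act :: "'g \<Rightarrow> 'l::field \<Rightarrow> 'l"
    and K R A RG :: "'l set"
    and n :: nat
    and a :: "nat \<Rightarrow> 'l"
    and E \<G> :: "'l mpoly set"
    and mo :: "monom rel"
    and \<phi> :: "'l \<Rightarrow> 'l"
  assumes "acts_by_automorphisms G act"
    and "subring K ring_of_type_algebra"
    and "K \<subseteq> fixed G act UNIV"
    and "R = subalgebra_gen K (a ` {..<n})"
    and "G_stable G act R"
    and "has_Quot_UNIV R"
    and "extended_Derksen_ideal G act n a E"
    and "monomial_ordering n mo"
    and "reduced_Groebner_basis n mo E \<G>"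
    and "A = subalgebra_gen K (coeffs_of \<G>)"
    and "RG = fixed G act R"
    and "\<phi> = invariantization n mo K a \<G>"
  shows "(\<forall>b\<in>R. \<exists>!v. invariantization_rel n mo K a \<G> b v) \<and>
    is_module_hom (sub_ring RG) (sub_mod R) (sub_mod A) \<phi> \<and>
    (\<forall>b\<in>RG. \<phi> b = b) \<and>
    (\<forall>c\<in>RG. c \<noteq> 0 \<longrightarrow> A \<subseteq> localize R c \<longrightarrow> localize RG c = localize A c \<longrightarrow>
       (\<exists>!\<psi>. \<psi> \<in> extensional (localize R c) \<and>
          is_module_hom (sub_ring (localize RG c))
            (sub_mod (localize R c)) (sub_mod (localize RG c)) \<psi> \<and>
          \<psi> ` localize R c = localize RG c \<and>
          (\<forall>x\<in>localize RG c. \<psi> x = x) \<and>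
          (\<forall>b\<in>R. \<psi> b = \<phi> b)) \<and>
       is_direct_summand (localize RG c) (sub_ring (localize RG c)) (sub_mod (localize R c)))"
proof -
  interpret invariantization_setting n mo E \<G> G act K a
    using assms(1-3,7-9)
    by (intro invariantization_setting.intro reduced_Groebner.intro monomial_order.intro
        reduced_Groebner_axioms.intro invariantization_setting_axioms.intro)
      (simp_all add: extended_Derksen_ideal_def)
  note eqs = assms(4,10-12)
  have unique: "\<forall>b\<in>R. \<exists>!v. invariantization_rel n mo K a \<G> b v"
    using invariantization_well_defined by (simp add: eqs)
  have hom: "is_module_hom (sub_ring RG) (sub_mod R) (sub_mod A) \<phi>"
    unfolding eqs
    by (subst is_module_hom_sub_iff)
      (auto simp: subrings RG_subset_A invariantization_in_A invariantization_add
        invariantization_linear subsetD[OF subrings(4)])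
  have id: "\<forall>b\<in>RG. \<phi> b = b"
    using invariantization_invariant by (simp add: eqs)
  have retraction: "retraction_to_localize RG R c \<phi>"
    if "c \<in> RG" "c \<noteq> 0" "localize RG c = localize A c" for c
  proof (rule retraction_to_localize.intro)
    fix x assume "x \<in> R"
    \<comment> \<open>\<open>A\<close> need not consist of invariants; it is contained in its localization, which equals that of
      the ring of invariants.\<close>
    then have "\<phi> x \<in> A" unfolding eqs by (rule invariantization_in_A)
    then show "\<phi> x \<in> localize RG c" using that(3) localize_incl(1) by blast
  qed (use that in \<open>simp_all add: eqs subrings invariantization_add invariantization_linear
      invariantization_invariant\<close>)
  show ?thesis
  proof (intro conjI unique hom id ballI impI)
    fix c assume c: "c \<in> RG" "c \<noteq> 0" "localize RG c = localize A c"
    interpret retraction_to_localize RG R c \<phi> by (rule retraction[OF c])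
    show "\<exists>!\<psi>. \<psi> \<in> extensional (localize R c) \<and>
        is_module_hom (sub_ring (localize RG c)) (sub_mod (localize R c)) (sub_mod (localize RG c)) \<psi> \<and>
        \<psi> ` localize R c = localize RG c \<and> (\<forall>x\<in>localize RG c. \<psi> x = x) \<and> (\<forall>b\<in>R. \<psi> b = \<phi> b)"
      by (rule extension_exists_unique)
    show "is_direct_summand (localize RG c) (sub_ring (localize RG c)) (sub_mod (localize R c))"
      by (rule direct_summand)
  qed
qed

end
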